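(* For $p\in[-1,1]$ let $\alpha=1$ if $p\in(-1,1)$ and $\alpha=1/2$ if $p=1$. Then as $N\to\infty$, $$\frac{1}{N^\alpha}\widehat D_{1,1}^{(N,1)}(\sqrt Np+\chi)\to\begin{cases}\rho_{\mathrm b}(p),&p\in(-1,1),\\ \rho_{\mathrm e}(\chi),&p=1,\end{cases}$$ uniformly for $\chi$ in compact subsets of $\mathbb{R}$, where $\rho_{\mathrm b}(p)=\frac23(1-p^2)$ and $$\rho_{\mathrm e}(\chi)=\frac{\sqrt2}{3\sqrt\pi}\frac{e^{-4\chi^2}+\sqrt{2\pi}\chi e^{-2\chi^2}\operatorname{erfc}(\sqrt2\chi)-4\sqrt\pi\chi\operatorname{erfc}(2\chi)}{\sqrt2\operatorname{erfc}(2\chi)-e^{-2\chi^2}\operatorname{erfc}(\sqrt2\chi)}.$$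
   Context: $dA(z)=d^2z/\pi$; $Z_N^{(\mathrm g)}=N!\prod_{k=0}^{N-1}\frac{(2k+1)!}{2^{2k+1}}$. For $a\in\mathbb{R}$ let $\omega^{(\mathrm{over})}(z)=|z-a|^2(1+|z-a|^2)e^{-2|z|^2}$ and $Z_{N-1}^{(\mathrm{over})}(a)=\int_{\mathbb{C}^{N-1}}\prod_{j<k}|w_j-w_k|^2|w_j-\overline w_k|^2\prod_{j}|w_j-\overline w_j|^2\omega^{(\mathrm{over})}(w_j)dA(w_j)$. The Gaussian (symplectic Ginibre) skew-kernel is $\varkappa_N^{(\mathrm g)}(z,w)=\sqrt2\sum_{k=0}^{N-1}\sum_{\ell=0}^k\Big(\frac{(\sqrt2z)^{2k+1}}{(2k+1)!!}\frac{(\sqrt2w)^{2\ell}}{(2\ell)!!}-\frac{(\sqrt2w)^{2k+1}}{(2k+1)!!}\frac{(\sqrt2z)^{2\ell}}{(2\ell)!!}\Big)$ and $\widehat\varkappa_N^{(\mathrm g)}(x,a)=e^{-2xa}\varkappa_N^{(\mathrm g)}(x,a)$. For $a\in\mathbb{R}$, the conditional mean diagonal overlap of the symplectic Ginibre ensemble (mean diagonal eigenvector overlap density divided by the eigenvalue density, extended continuously to the real axis) is $$\widehat D_{1,1}^{(N,1)}(a)=\frac{NZ_{N-1}^{(\mathrm{over})}(a)}{Z_N^{(\mathrm g)}}\cdot\frac{e^{-2a^2}}{\partial_x\widehat\varkappa_N^{(\mathrm g)}(x,a)\big|_{x=a}}.$$ *)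

theory Defs
  imports "HOL-Analysis.Analysis"
begin

fun dfact :: "nat \<Rightarrow> nat" where
  "dfact 0 = 1"
| "dfact (Suc 0) = 1"
| "dfact (Suc (Suc n)) = Suc (Suc n) * dfact n"

text \<open>Normalisation constant of the symplectic Ginibre ensemble.\<close>
definition Zg :: "nat \<Rightarrow> real" where
  "Zg N = fact N * (\<Prod>k<N. fact (2*k+1) / 2 ^ (2*k+1))"

definition omega_over :: "real \<Rightarrow> complex \<Rightarrow> real" where
  "omega_over a z = (cmod (z - of_real a))\<^sup>2 * (1 + (cmod (z - of_real a))\<^sup>2) * exp (-2 * (cmod z)\<^sup>2)"

text \<open>Z_n^(over)(a), integral over C^n with dA = d^2 z / pi in each variable.\<close>
definition Zover :: "nat \<Rightarrow> real \<Rightarrow> real" where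
  "Zover n a = (1 / pi) ^ n *
     (LINT w | PiM {..<n} (\<lambda>_. (lborel :: complex measure)).
        (\<Prod>j<n. \<Prod>k\<in>{j<..<n}. (cmod (w j - w k))\<^sup>2 * (cmod (w j - cnj (w k)))\<^sup>2) *
        (\<Prod>j<n. (cmod (w j - cnj (w j)))\<^sup>2 * omega_over a (w j)))"

text \<open>Gaussian symplectic Ginibre skew-kernel.\<close>
definition kappa :: "nat \<Rightarrow> 'a::real_normed_field \<Rightarrow> 'a \<Rightarrow> 'a" where
  "kappa N z w = of_real (sqrt 2) * (\<Sum>k<N. \<Sum>l\<le>k.
      (of_real (sqrt 2) * z) ^ (2*k+1) / of_nat (dfact (2*k+1)) * (of_real (sqrt 2) * w) ^ (2*l) / of_nat (dfact (2*l))
    - (of_real (sqrt 2) * w) ^ (2*k+1) / of_nat (dfact (2*k+1)) * (of_real (sqrt 2) * z) ^ (2*l) / of_nat (dfact (2*l)))"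

definition kappa_hat :: "nat \<Rightarrow> real \<Rightarrow> real \<Rightarrow> real" where
  "kappa_hat N x a = exp (-2 * x * a) * kappa N x a"

text \<open>Conditional mean diagonal overlap on the real axis.\<close>
definition Dhat :: "nat \<Rightarrow> real \<Rightarrow> real" where
  "Dhat N a = real N * Zover (N - 1) a / Zg N * (exp (-2 * a\<^sup>2) / deriv (\<lambda>x. kappa_hat N x a) a)"

definition erfc :: "real \<Rightarrow> real" where
  "erfc x = 2 / sqrt pi * integral {x..} (\<lambda>t. exp (- t\<^sup>2))"

definition rho_b :: "real \<Rightarrow> real" where
  "rho_b p = 2/3 * (1 - p\<^sup>2)"

definition rho_e :: "real \<Rightarrow> real" where
  "rho_e c = sqrt 2 / (3 * sqrt pi) *
     ((exp (-4 * c\<^sup>2) + sqrt (2*pi) * c * exp (-2 * c\<^sup>2) * erfc (sqrt 2 * c) - 4 * sqrt pi * c * erfc (2*c))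
      / (sqrt 2 * erfc (2*c) - exp (-2 * c\<^sup>2) * erfc (sqrt 2 * c)))"

end

theory Submission
  imports Defs "HOL-Probability.Distributions" "HOL-Real_Asymp.Real_Asymp" "Jordan_Normal_Form.Determinant"
begin

text \<open>
  Put \<open>y = a\<^sup>2\<close>, \<open>e n y = \<Sum>j\<le>n. y^j/j!\<close> and \<open>g N y = y^N / pochhammer (1/2) N\<close>. Both factors of the overlap have
  closed forms. The slope of the skew-kernel telescopes to \<open>2 (e (2N) (2y) - g N y * e N y)\<close>. For the partition
  function, the interaction together with the factors \<open>|w - a|\<^sup>2\<close> is the Vandermonde determinant of the \<open>2n + 1\<close> points
  \<open>w_j, cnj w_j, a\<close>. Expanding it in monic skew-orthogonal polynomials \<open>q\<close> of the weight
  \<open>(1 + |z - a|\<^sup>2) exp (-2|z|\<^sup>2)\<close>, whose skew moment matrix is pentadiagonal, leaves \<open>n!\<close> times the product of the doubled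
  skew norms times \<open>q (2n)\<close> evaluated at \<open>a\<close>; the resulting recursion in \<open>n\<close> is solved by
  \<open>2/3 ((2N + 1 - 2y) e (2N) (2y) - (N + 1 - y) g N y * e N y + y * g N y * y^N/N!)\<close> with \<open>N = n + 1\<close>.

  After multiplication by \<open>exp (-2y)\<close> everything is expressed by Poisson distribution functions and point probabilities
  at distance \<open>(y - N)/sqrt N\<close> standard deviations from the mean. Dominated convergence for the integral
  representation of the Poisson distribution function (which also yields Stirling's constant) gives the Gaussian limits:
  the distance tends to minus infinity in the bulk and to \<open>2\<chi>\<close> at the edge.
\<close>

section \<open>Vandermonde determinants and sums over permutations\<close>

text \<open>Moving \<open>|w - a|\<^sup>2\<close> from the weight into the Vandermonde determinant
  is what makes the skew-orthogonal polynomials computable. The weight that remains is quadratic in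
  \<open>z - a\<close>, so Gram-Schmidt corrects each polynomial by the preceding pair only, and the
  skew norms, freed of their factorial factors, obey a Riccati recursion that the sums
  \<open>pre_norm\<close> linearise. The price is an odd number of points; orthogonality leaves only
  the terms that give the polynomial of top degree to the unpaired point \<open>a\<close>. The
  recursion for the values at \<open>a\<close> has as inhomogeneous term the same weighted sum that
  builds up the slope of the kernel, which is why both closed forms live on the same few functions.
  At the edge \<open>N - y\<close> is only of order \<open>sqrt N\<close>, so the terms of order
  \<open>N\<close> in the numerator disappear; hence the exponent \<open>1/2\<close>. Uniformity in
  \<chi> comes from letting \<chi> run along convergent sequences.\<close>

lemma det_monic_family_eq_power:
  fixes q :: "nat \<Rightarrow> 'a::idom poly"
  assumes monic: "\<And>i. i < n \<Longrightarrow> degree (q i) = i \<and> lead_coeff (q i) = 1"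
  shows "Determinant.det (Matrix.mat n n (\<lambda>(i, k). poly (q k) (x i))) = Determinant.det (Matrix.mat n n (\<lambda>(i, k). x i ^ k))"
proof -
  let ?V = "Matrix.mat n n (\<lambda>(i, k). x i ^ k)"
  \<comment> \<open>Column \<open>k\<close> lists the coefficients of \<open>q k\<close>, so
    \<open>?C\<close> is unitriangular and multiplication by it preserves the determinant.\<close>
  let ?C = "Matrix.mat n n (\<lambda>(j, k). coeff (q k) j)"
  have "Matrix.mat n n (\<lambda>(i, k). poly (q k) (x i)) = ?V * ?C"
  proof (rule eq_matI)
    fix i k assume "i < dim_row (?V * ?C)" "k < dim_col (?V * ?C)"
    hence ik: "i < n" "k < n" by simp_all
    have "poly (q k) (x i) = (\<Sum>j\<le>k. coeff (q k) j * x i ^ j)"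
      using monic[OF ik(2)] by (simp add: poly_altdef)
    also have "\<dots> = (\<Sum>j<n. coeff (q k) j * x i ^ j)"
      using ik monic[OF ik(2)] by (intro sum.mono_neutral_left) (auto simp: coeff_eq_0)
    also have "\<dots> = (\<Sum>j<n. x i ^ j * coeff (q k) j)"
      by (simp add: mult.commute)
    finally show "Matrix.mat n n (\<lambda>(i, k). poly (q k) (x i)) $$ (i, k) = (?V * ?C) $$ (i, k)"
      using ik by (simp add: scalar_prod_def lessThan_atLeast0)
  qed simp_all
  moreover have "Determinant.det ?C = 1"
  proof -
    have "Determinant.det ?C = prod_list (diag_mat ?C)"
    proof (rule det_upper_triangular[of _ n])
      show "upper_triangular ?C"
      proof
        fix j k assume jk: "k < j" "j < dim_row ?C"
        hence "degree (q k) < j" using monic[of k] by simp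
        thus "?C $$ (j, k) = 0" using jk by (simp add: coeff_eq_0)
      qed
    qed simp
    also have "\<dots> = 1"
    proof -
      have "coeff (q k) k = 1" if "k < n" for k using monic[OF that] by (elim conjE) simp
      thus ?thesis unfolding prod_list_diag_prod by (intro prod.neutral) simp
    qed
    finally show ?thesis .
  qed
  ultimately show ?thesis by (simp add: det_mult[of _ n])
qed

lemma det_monic_family:
  fixes q :: "nat \<Rightarrow> 'a::idom poly"
  assumes monic: "\<And>i. i < n \<Longrightarrow> degree (q i) = i \<and> lead_coeff (q i) = 1"
  shows "Determinant.det (Matrix.mat n n (\<lambda>(i, k). poly (q k) (x i))) = (\<Prod>i<n. \<Prod>j<i. x i - x j)"
proof -
  \<comment> \<open>In the Newton basis the evaluation matrix is triangular.\<close>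
  define b where "b k = (\<Prod>j<k. [:- x j, 1:])" for k
  have b: "degree (b k) = k \<and> lead_coeff (b k) = 1" for k
  proof
    show "degree (b k) = k" by (simp add: b_def degree_prod_eq_sum_degree)
    show "lead_coeff (b k) = 1" unfolding b_def lead_coeff_prod by simp
  qed
  let ?B = "Matrix.mat n n (\<lambda>(i, k). poly (b k) (x i))"
  have "Determinant.det (Matrix.mat n n (\<lambda>(i, k). poly (q k) (x i))) = Determinant.det ?B"
    by (rule trans[OF det_monic_family_eq_power[OF monic] det_monic_family_eq_power[OF b, symmetric]])
  also have "\<dots> = prod_list (diag_mat ?B)"
    by (intro det_lower_triangular[of n]) (auto simp: b_def poly_prod)
  also have "\<dots> = (\<Prod>i<n. \<Prod>j<i. x i - x j)"
    unfolding prod_list_diag_prod by (simp add: b_def poly_prod lessThan_atLeast0)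
  finally show ?thesis .
qed

text \<open>Leibniz expansion in an arbitrary monic basis; the freedom to choose \<open>q\<close> is
  what later admits skew-orthogonal polynomials.\<close>

lemma prod_monic_family_permutations:
  fixes q :: "nat \<Rightarrow> 'a::idom poly"
  assumes monic: "\<And>i. i < n \<Longrightarrow> degree (q i) = i \<and> lead_coeff (q i) = 1"
  shows "(\<Prod>i<n. \<Prod>j<i. x i - x j)
    = (\<Sum>p | p permutes {..<n}. of_int (sign p) * (\<Prod>i<n. poly (q (p i)) (x i)))"
proof -
  let ?M = "Matrix.mat n n (\<lambda>(i, k). poly (q k) (x i))"
  have "(\<Prod>i = 0..<n. ?M $$ (i, p i)) = (\<Prod>i<n. poly (q (p i)) (x i))"
    if "p permutes {0..<n}" for p
    unfolding lessThan_atLeast0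
  proof (rule prod.cong[OF refl])
    fix i assume "i \<in> {0..<n}"
    thus "?M $$ (i, p i) = poly (q (p i)) (x i)"
      using permutes_in_image[OF that, of i] by simp
  qed
  hence "(\<Sum>p | p permutes {0..<n}. signof p * (\<Prod>i = 0..<n. ?M $$ (i, p i)))
      = (\<Sum>p | p permutes {..<n}. of_int (sign p) * (\<Prod>i<n. poly (q (p i)) (x i)))"
    unfolding lessThan_atLeast0 by (intro sum.cong refl) simp
  moreover have "Determinant.det ?M = (\<Sum>p | p permutes {0..<n}. signof p * (\<Prod>i = 0..<n. ?M $$ (i, p i)))"
    by (rule det_def') simp
  moreover have "Determinant.det ?M = (\<Prod>i<n. \<Prod>j<i. x i - x j)"
    by (rule det_monic_family[OF monic])
  ultimately show ?thesis by metis
qed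

text \<open>The left side is \<open>2^n n!\<close> times the Pfaffian of \<open>m\<close>, an
  antisymmetric matrix made of 2 by 2 blocks. The step to \<open>Suc n\<close> classifies
  permutations by the position of the index \<open>2n + 1\<close>: by symmetry all positions
  contribute equally, and in the last one orthogonality forces the neighbour to be
  \<open>2n\<close>.\<close>

lemma sum_pairing_permutations:
  fixes m :: "nat \<Rightarrow> nat \<Rightarrow> 'a::{comm_ring_1,ring_char_0}"
  assumes anti: "\<And>i k. i < 2 * n \<Longrightarrow> k < 2 * n \<Longrightarrow> m i k = - m k i"
    and orth: "\<And>i k. i < 2 * n \<Longrightarrow> k < 2 * n \<Longrightarrow> i div 2 \<noteq> k div 2 \<Longrightarrow> m i k = 0"
  shows "(\<Sum>p | p permutes {..<2 * n}. of_int (sign p) * (\<Prod>j<n. m (p (2 * j)) (p (2 * j + 1))))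
    = fact n * (\<Prod>k<n. 2 * m (2 * k) (2 * k + 1))"
  using assms
proof (induction n)
  case 0
  have "{p. p permutes {..<0::nat}} = {id}" by auto
  thus ?case by (simp add: sign_id)
next
  case (Suc n)
  let ?P = "{p. p permutes {..<2 * Suc n}}"
  let ?F = "\<lambda>p. of_int (sign p) * (\<Prod>j<Suc n. m (p (2 * j)) (p (2 * j + 1)))"
  define S where "S i = {p \<in> ?P. p i = 2 * n + 1}" for i
  have fin: "finite ?P" by (rule finite_permutations) simp
  have lt: "p i < 2 * Suc n" if "p \<in> ?P" "i < 2 * Suc n" for p i
    using that permutes_in_image[of p "{..<2 * Suc n}" i] by auto
  have perm: "permutation p" if "p \<in> ?P" for p
    using that unfolding permutation_permutes by blast
  have UN: "?P = (\<Union>i\<in>{..<2 * Suc n}. S i)"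
  proof (intro equalityI subsetI)
    fix p assume p: "p \<in> ?P"
    hence "2 * n + 1 \<in> p ` {..<2 * Suc n}" by (simp add: permutes_image)
    then obtain i where "i < 2 * Suc n" "p i = 2 * n + 1" by (metis imageE lessThan_iff)
    thus "p \<in> (\<Union>i\<in>{..<2 * Suc n}. S i)" using p unfolding S_def by blast
  qed (auto simp: S_def)
  have disj: "S i \<inter> S k = {}" if "i \<noteq> k" for i k
  proof -
    have False if "p \<in> S i" "p \<in> S k" for p
    proof -
      have "inj p" using that(1) permutes_inj unfolding S_def by blast
      moreover have "p i = p k" using that by (simp add: S_def)
      ultimately show False using \<open>i \<noteq> k\<close> by (simp add: inj_eq)
    qed
    thus ?thesis by blast
  qed
  \<comment> \<open>Composing with a position permutation that preserves the summand moves the largest index to the last position.\<close>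
  have move: "sum ?F (S i) = sum ?F (S k)"
    if t: "t permutes {..<2 * Suc n}" "t k = i" "t \<circ> t = id"
      and inv: "\<And>p. p \<in> ?P \<Longrightarrow> ?F (p \<circ> t) = ?F p" for t i k
  proof (rule sum.reindex_bij_witness[of _ "\<lambda>p. p \<circ> t" "\<lambda>p. p \<circ> t"])
    fix p :: "nat \<Rightarrow> nat"
    have tt: "t i = k" using fun_cong[OF t(3), of k] t(2) by simp
    show "p \<circ> t \<circ> t = p" "p \<circ> t \<circ> t = p" using t(3) by (simp_all add: o_assoc[symmetric])
    show "p \<circ> t \<in> S k" if "p \<in> S i"
      using that t permutes_compose[OF t(1)] by (simp add: S_def)
    show "p \<circ> t \<in> S i" if "p \<in> S k"
      using that tt permutes_compose[OF t(1)] by (simp add: S_def)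
    show "?F (p \<circ> t) = ?F p" if "p \<in> S i"
      using that inv unfolding S_def by blast
  qed
  have odd: "sum ?F (S (2 * j + 1)) = sum ?F (S (2 * n + 1))" if j: "j < Suc n" for j
  proof (cases "j = n")
    case False
    hence jn: "j < n" using j by simp
    \<comment> \<open>Exchanging block \<open>j\<close> with block \<open>n\<close> takes two
      transpositions, hence is even, and only reorders the factors of the product.\<close>
    define t where "t = Transposition.transpose (2 * j) (2 * n) \<circ> Transposition.transpose (2 * j + 1) (2 * n + 1)"
    have par: "2 * (a::nat) \<noteq> 2 * b + 1" "2 * b + 1 \<noteq> 2 * a" "2 * (a::nat) \<noteq> Suc (2 * b)" "Suc (2 * b) \<noteq> 2 * a" for a b by presburger+
    have tv: "t (2 * i) = 2 * Transposition.transpose j n i" "t (2 * i + 1) = 2 * Transposition.transpose j n i + 1" for i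
      by (simp_all add: t_def Transposition.transpose_def par)
    have tP: "t permutes {..<2 * Suc n}"
      unfolding t_def using jn by (intro permutes_compose permutes_swap_id) auto
    have sg: "sign t = 1"
      unfolding t_def using jn by (subst sign_compose) (auto simp: permutation_swap_id sign_swap_id)
    show ?thesis
    proof (rule move[OF tP])
      show "t (2 * n + 1) = 2 * j + 1" by (simp only: tv transpose_apply_second)
      show "t \<circ> t = id"
      proof
        fix i show "(t \<circ> t) i = id i"
        proof (cases "even i")
          case True
          then obtain k where "i = 2 * k" by blast
          thus ?thesis by (simp only: o_apply tv transpose_involutory id_apply)
        next
          case False
          then obtain k where "i = 2 * k + 1" by (blast elim: oddE)
          thus ?thesis by (simp only: o_apply tv transpose_involutory id_apply)
        qed
      qed
      fix p assume p: "p \<in> ?P"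
      have "(\<Prod>i<Suc n. m ((p \<circ> t) (2 * i)) ((p \<circ> t) (2 * i + 1)))
          = (\<Prod>i<Suc n. m (p (2 * Transposition.transpose j n i)) (p (2 * Transposition.transpose j n i + 1)))"
        by (simp only: o_apply tv)
      also have "\<dots> = (\<Prod>i<Suc n. m (p (2 * i)) (p (2 * i + 1)))"
        by (rule prod.reindex_bij_betw[of "Transposition.transpose j n" "{..<Suc n}" "{..<Suc n}" "\<lambda>i. m (p (2 * i)) (p (2 * i + 1))"])
           (use jn in \<open>auto intro!: permutes_imp_bij permutes_swap_id\<close>)
      moreover have "sign (p \<circ> t) = sign p"
        using perm[OF p] perm[of t] tP sg by (simp add: sign_compose)
      ultimately show "?F (p \<circ> t) = ?F p" by simp
    qed
  qed simp
  have even: "sum ?F (S (2 * j)) = sum ?F (S (2 * j + 1))" if j: "j < Suc n" for j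
  proof (rule move)
    \<comment> \<open>A swap inside a block flips the sign of the permutation and, by antisymmetry,
      the sign of one factor.\<close>
    let ?t = "Transposition.transpose (2 * j) (2 * j + 1)"
    show tP: "?t permutes {..<2 * Suc n}" using j by (intro permutes_swap_id) auto
    show "?t (2 * j + 1) = 2 * j" "?t \<circ> ?t = id" by auto
    fix p assume p: "p \<in> ?P"
    have "(\<Prod>i<Suc n. m ((p \<circ> ?t) (2 * i)) ((p \<circ> ?t) (2 * i + 1)))
        = (\<Prod>i\<in>{..<Suc n} - {j}. m (p (2 * i)) (p (2 * i + 1))) * m (p (2 * j + 1)) (p (2 * j))"
    proof -
      have "(\<Prod>i\<in>{..<Suc n} - {j}. m ((p \<circ> ?t) (2 * i)) ((p \<circ> ?t) (2 * i + 1)))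
          = (\<Prod>i\<in>{..<Suc n} - {j}. m (p (2 * i)) (p (2 * i + 1)))"
      proof (rule prod.cong[OF refl])
        fix i assume "i \<in> {..<Suc n} - {j}"
        hence "2 * i \<noteq> 2 * j" "2 * i + 1 \<noteq> 2 * j + 1" "2 * i \<noteq> 2 * j + 1" "2 * i + 1 \<noteq> 2 * j" by simp_all
        hence "?t (2 * i) = 2 * i" "?t (2 * i + 1) = 2 * i + 1" by (simp_all only: Transposition.transpose_def if_False)
        thus "m ((p \<circ> ?t) (2 * i)) ((p \<circ> ?t) (2 * i + 1)) = m (p (2 * i)) (p (2 * i + 1))"
          by (simp only: o_apply)
      qed
      moreover have "(\<Prod>i<Suc n. m ((p \<circ> ?t) (2 * i)) ((p \<circ> ?t) (2 * i + 1)))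
          = m ((p \<circ> ?t) (2 * j)) ((p \<circ> ?t) (2 * j + 1))
            * (\<Prod>i\<in>{..<Suc n} - {j}. m ((p \<circ> ?t) (2 * i)) ((p \<circ> ?t) (2 * i + 1)))"
        using j by (intro prod.remove) simp_all
      ultimately show ?thesis
        by (simp only: o_apply transpose_apply_first transpose_apply_second mult.commute)
    qed
    also have "\<dots> = - (\<Prod>i<Suc n. m (p (2 * i)) (p (2 * i + 1)))"
    proof -
      have "m (p (2 * j + 1)) (p (2 * j)) = - m (p (2 * j)) (p (2 * j + 1))"
        using j lt[OF p, of "2 * j"] lt[OF p, of "2 * j + 1"] by (intro Suc.prems(1)) simp_all
      moreover have "(\<Prod>i<Suc n. m (p (2 * i)) (p (2 * i + 1)))
          = m (p (2 * j)) (p (2 * j + 1)) * (\<Prod>i\<in>{..<Suc n} - {j}. m (p (2 * i)) (p (2 * i + 1)))"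
        using j by (intro prod.remove) simp_all
      ultimately show ?thesis by (simp only: mult.commute mult_minus_left)
    qed
    moreover have "sign (p \<circ> ?t) = - sign p"
      using perm[OF p] by (simp add: sign_compose permutation_swap_id sign_swap_id)
    ultimately show "?F (p \<circ> ?t) = ?F p" by simp
  qed
  let ?R = "{p. p permutes {..<2 * n}}"
  have R: "?R \<subseteq> S (2 * n + 1)"
  proof
    fix p assume p: "p \<in> ?R"
    hence "p permutes {..<2 * Suc n}" by (auto elim: permutes_subset)
    moreover have "p (2 * n + 1) = 2 * n + 1" using p by (simp add: permutes_not_in)
    ultimately show "p \<in> S (2 * n + 1)" by (simp add: S_def)
  qed
  have "sum ?F (S (2 * n + 1)) = sum ?F ?R"
  proof (rule sum.mono_neutral_right)
    show "finite (S (2 * n + 1))" using fin by (simp add: S_def)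
    show "?R \<subseteq> S (2 * n + 1)" by (rule R)
    \<comment> \<open>If the neighbour of \<open>2n + 1\<close> is not \<open>2n\<close>, it lies in
      another block and its factor vanishes by orthogonality.\<close>
    show "\<forall>p\<in>S (2 * n + 1) - ?R. ?F p = 0"
    proof
      fix p assume p: "p \<in> S (2 * n + 1) - ?R"
      hence pP: "p \<in> ?P" and pn: "p (2 * n + 1) = 2 * n + 1" unfolding S_def by blast+
      have "p (2 * n) \<noteq> 2 * n"
      proof
        assume pe: "p (2 * n) = 2 * n"
        have "p permutes {..<2 * n}"
        proof (rule permutes_superset[of p "{..<2 * Suc n}"])
          fix x assume "x \<in> {..<2 * Suc n} - {..<2 * n}"
          hence "2 * n \<le> x" "x < 2 * n + 2" by simp_all
          hence "x = 2 * n \<or> x = 2 * n + 1" by linarith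
          thus "p x = x" using pn pe by (elim disjE) simp_all
        qed (use pP in blast)
        thus False using p by blast
      qed
      moreover have "p (2 * n) \<noteq> 2 * n + 1"
      proof
        assume "p (2 * n) = 2 * n + 1"
        hence "p (2 * n) = p (2 * n + 1)" using pn by simp
        moreover have "inj p" using pP permutes_inj by blast
        ultimately show False by (simp add: inj_eq)
      qed
      ultimately have "p (2 * n) div 2 \<noteq> n" by presburger
      hence "m (p (2 * n)) (p (2 * n + 1)) = 0"
        using lt[OF pP, of "2 * n"] pn by (intro Suc.prems(2)) auto
      thus "?F p = 0" by simp
    qed
  qed
  also have "\<dots> = (\<Sum>p\<in>?R. (of_int (sign p) * (\<Prod>j<n. m (p (2 * j)) (p (2 * j + 1)))) * m (2 * n) (2 * n + 1))"
  proof (rule sum.cong[OF refl])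
    fix p assume "p \<in> ?R"
    hence "p (2 * n) = 2 * n" "p (2 * n + 1) = 2 * n + 1" by (auto intro!: permutes_not_in)
    thus "?F p = (of_int (sign p) * (\<Prod>j<n. m (p (2 * j)) (p (2 * j + 1)))) * m (2 * n) (2 * n + 1)"
      by (simp add: mult.assoc)
  qed
  also have "\<dots> = fact n * (\<Prod>k<n. 2 * m (2 * k) (2 * k + 1)) * m (2 * n) (2 * n + 1)"
  proof -
    have "(\<Sum>p\<in>?R. of_int (sign p) * (\<Prod>j<n. m (p (2 * j)) (p (2 * j + 1))))
        = fact n * (\<Prod>k<n. 2 * m (2 * k) (2 * k + 1))"
    proof (rule Suc.IH)
      show "m i k = - m k i" if "i < 2 * n" "k < 2 * n" for i k
        using that by (intro Suc.prems(1)) simp_all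
      show "m i k = 0" if "i < 2 * n" "k < 2 * n" "i div 2 \<noteq> k div 2" for i k
        using that by (intro Suc.prems(2)) simp_all
    qed
    thus ?thesis by (simp only: sum_distrib_right[symmetric])
  qed
  finally have last: "sum ?F (S (2 * n + 1)) = fact n * (\<Prod>k<n. 2 * m (2 * k) (2 * k + 1)) * m (2 * n) (2 * n + 1)" .
  have "sum ?F ?P = (\<Sum>i<2 * Suc n. sum ?F (S i))"
    unfolding UN using fin disj by (intro sum.UNION_disjoint) (auto simp: S_def)
  also have "\<dots> = (\<Sum>i<2 * Suc n. sum ?F (S (2 * n + 1)))"
  proof (rule sum.cong[OF refl])
    fix i assume "i \<in> {..<2 * Suc n}"
    hence "i div 2 < Suc n" by auto
    thus "sum ?F (S i) = sum ?F (S (2 * n + 1))"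
    proof (cases "even i")
      case True
      hence "i = 2 * (i div 2)" by simp
      thus ?thesis using odd[of "i div 2"] even[of "i div 2"] \<open>i div 2 < Suc n\<close> by metis
    next
      case False
      hence "i = 2 * (i div 2) + 1" by presburger
      thus ?thesis using odd[of "i div 2"] \<open>i div 2 < Suc n\<close> by metis
    qed
  qed
  \<comment> \<open>The number of positions supplies both the new factor of the factorial and the
    factor 2 of the new block.\<close>
  also have "\<dots> = of_nat (2 * Suc n) * sum ?F (S (2 * n + 1))" by simp
  also have "\<dots> = fact (Suc n) * (\<Prod>k<Suc n. 2 * m (2 * k) (2 * k + 1))"
    unfolding last by (simp add: algebra_simps)
  finally show ?case .
qed

section \<open>Truncated exponential series and the slope of the skew-kernel\<close>

definition exp_poly :: "nat \<Rightarrow> real \<Rightarrow> real" where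
  "exp_poly n y = (\<Sum>j\<le>n. y ^ j / fact j)"

text \<open>In terms of the Gamma function this is \<open>sqrt pi * y^n / Gamma (n + 1/2)\<close>,
  the half-integer analogue of \<open>y^n / n!\<close>; it stems from the odd double factorials in
  the kernel.\<close>

definition half_term :: "nat \<Rightarrow> real \<Rightarrow> real" where
  "half_term n y = y ^ n / pochhammer (1/2) n"

lemma exp_poly_0 [simp]: "exp_poly 0 y = 1"
  by (simp add: exp_poly_def)

lemma exp_poly_Suc: "exp_poly (Suc n) y = exp_poly n y + y ^ n / fact n * (y / (real n + 1))"
  by (simp add: exp_poly_def field_simps)

lemma half_term_0 [simp]: "half_term 0 y = 1"
  by (simp add: half_term_def)

lemma half_term_Suc: "half_term (Suc n) y = half_term n y * (2 * y / (2 * real n + 1))"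
  by (simp add: half_term_def pochhammer_Suc field_simps)

text \<open>Duplication formula \<open>(2n)! = 4^n n! (1/2)_n\<close>. It expresses the terms of the
  series at \<open>2y\<close> by those at \<open>y\<close>, so that the later identities become
  rational in a few common quantities.\<close>

lemma double_term: "(2 * y) ^ (2 * n) / fact (2 * n) = half_term n y * (y ^ n / fact n)"
proof (induction n)
  case (Suc n)
  have "(2 * y) ^ (2 * Suc n) / fact (2 * Suc n)
      = (2 * y) ^ (2 * n) / fact (2 * n) * (4 * y\<^sup>2 / ((2 * real n + 1) * (2 * real n + 2)))"
    by (simp add: power2_eq_square field_simps)
  also have "\<dots> = half_term (Suc n) y * (y ^ Suc n / fact (Suc n))"
    unfolding Suc.IH half_term_Suc by (simp add: divide_simps power2_eq_square)
  finally show ?case .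
qed simp

lemma exp_poly_double_Suc:
  "exp_poly (2 * Suc n) (2 * y) = exp_poly (2 * n) (2 * y)
     + half_term n y * (y ^ n / fact n) * (2 * y / (2 * real n + 1) * (1 + y / (real n + 1)))"
proof -
  have "exp_poly (2 * Suc n) (2 * y) = exp_poly (2 * n) (2 * y)
      + (2 * y) ^ (2 * n) / fact (2 * n) * (2 * y / (2 * real n + 1) * (1 + y / (real n + 1)))"
    by (simp add: exp_poly_Suc divide_simps) (simp add: algebra_simps)
  thus ?thesis by (simp only: double_term)
qed

text \<open>The weight \<open>2k + 1 - 2l\<close> is the difference of the two exponents in a
  summand of \<open>kappa\<close>, produced by differentiating on the diagonal.\<close>

lemma sum_weighted_exp_poly:
  "(\<Sum>l\<le>k. (2 * real k + 1 - 2 * real l) * (y ^ l / fact l))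
     = (2 * real k + 1 - 2 * y) * exp_poly k y + 2 * y * (y ^ k / fact k)"
proof (induction k)
  case (Suc k)
  have "(\<Sum>l\<le>Suc k. (2 * real (Suc k) + 1 - 2 * real l) * (y ^ l / fact l))
      = (\<Sum>l\<le>k. (2 * real k + 1 - 2 * real l) * (y ^ l / fact l) + 2 * (y ^ l / fact l))
        + y ^ k / fact k * (y / (real k + 1))"
  proof -
    have "(\<Sum>l\<le>k. (2 * real (Suc k) + 1 - 2 * real l) * (y ^ l / fact l))
        = (\<Sum>l\<le>k. (2 * real k + 1 - 2 * real l) * (y ^ l / fact l) + 2 * (y ^ l / fact l))"
      by (intro sum.cong refl) (simp add: field_simps)
    moreover have "(2 * real (Suc k) + 1 - 2 * real (Suc k)) * (y ^ Suc k / fact (Suc k))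
        = y ^ k / fact k * (y / (real k + 1))"
      by (simp add: field_simps)
    ultimately show ?thesis by simp
  qed
  also have "\<dots> = (2 * real k + 1 - 2 * y) * exp_poly k y + 2 * y * (y ^ k / fact k)
        + 2 * exp_poly k y + y ^ k / fact k * (y / (real k + 1))"
    unfolding sum.distrib Suc.IH by (simp add: exp_poly_def sum_distrib_left)
  also have "\<dots> = (2 * real (Suc k) + 1 - 2 * y) * exp_poly (Suc k) y + 2 * y * (y ^ Suc k / fact (Suc k))"
    by (simp add: exp_poly_Suc divide_simps) (simp add: algebra_simps)
  finally show ?case .
qed (simp add: algebra_simps)

definition kernel_slope :: "nat \<Rightarrow> real \<Rightarrow> real" where
  "kernel_slope N y = 2 * (exp_poly (2 * N) (2 * y) - half_term N y * exp_poly N y)"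

lemma dfact_even: "real (dfact (2 * l)) = 2 ^ l * fact l"
  by (induction l) (simp_all add: algebra_simps)

lemma dfact_odd: "real (dfact (2 * k + 1)) = 2 ^ (k + 1) * pochhammer (1/2) (k + 1)"
proof (induction k)
  case (Suc k)
  have "real (dfact (2 * Suc k + 1)) = (2 * real k + 3) * real (dfact (2 * k + 1))"
    by (simp add: algebra_simps)
  thus ?case unfolding Suc.IH by (simp add: pochhammer_Suc algebra_simps)
qed simp

text \<open>The increment is the contribution of the outer index \<open>k = N\<close> to the
  derivative of \<open>kappa\<close>, in the form given by
  \<open>sum_weighted_exp_poly\<close>.\<close>

lemma kernel_slope_Suc:
  "kernel_slope (Suc N) y = kernel_slope N y
     + half_term N y * 2 / (2 * real N + 1) * ((2 * real N + 1 - 2 * y) * exp_poly N y + 2 * y * (y ^ N / fact N))"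
  unfolding kernel_slope_def exp_poly_double_Suc half_term_Suc exp_poly_Suc
  by (simp add: divide_simps) (simp add: algebra_simps)

lemma kappa_diag: "kappa N x x = (0::real)"
  by (simp add: kappa_def)

lemma kappa_Suc: "kappa (Suc N) x a = kappa N x a + sqrt 2 * (\<Sum>l\<le>N.
      (sqrt 2 * x) ^ (2*N+1) / (dfact (2*N+1)) * (sqrt 2 * a) ^ (2*l) / (dfact (2*l))
    - (sqrt 2 * a) ^ (2*N+1) / (dfact (2*N+1)) * (sqrt 2 * x) ^ (2*l) / (dfact (2*l)))" for x a :: real
  by (simp add: kappa_def algebra_simps)

lemma kappa_has_derivative:
  "((\<lambda>x. kappa N x a) has_real_derivative kernel_slope N (a\<^sup>2)) (at a)"
proof (induction N)
  case 0
  show ?case by (simp add: kappa_def kernel_slope_def)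
next
  case (Suc N)
  define y where "y = a\<^sup>2"
  have sq: "(sqrt 2 * a) ^ (2 * k) = (2 * y) ^ k" for k
    by (simp add: power_mult power_mult_distrib y_def)
  have s2: "sqrt 2 * (sqrt 2 * b) = 2 * b" for b
    by (simp flip: mult.assoc)
  \<comment> \<open>Derivative at \<open>x = a\<close> of the summand \<open>l\<close> in
    \<open>kappa_Suc\<close>; at \<open>l = 0\<close> the truncated exponent
    \<open>2 * l - 1\<close> is harmless because its factor \<open>l\<close> is zero.\<close>
  let ?d = "\<lambda>l. (2 * real N + 1) * sqrt 2 * (sqrt 2 * a) ^ (2*N) / (dfact (2*N+1)) * (sqrt 2 * a) ^ (2*l) / (dfact (2*l))
    - (sqrt 2 * a) ^ (2*N+1) / (dfact (2*N+1)) * (2 * real l * sqrt 2 * (sqrt 2 * a) ^ (2*l-1)) / (dfact (2*l))"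
  have d: "?d l = sqrt 2 * (half_term N y / (2 * real N + 1) * ((2 * real N + 1 - 2 * real l) * (y ^ l / fact l)))" for l
  proof -
    have "?d l = sqrt 2 * ((2 * real N + 1 - 2 * real l) * (sqrt 2 * a) ^ (2 * N) * (sqrt 2 * a) ^ (2 * l)
        / (real (dfact (2*N+1)) * real (dfact (2*l))))"
    proof (cases l)
      case 0
      thus ?thesis by simp
    next
      case (Suc m)
      have "(sqrt 2 * a) ^ (2*N+1) * (sqrt 2 * a) ^ (2*l-1) = (sqrt 2 * a) ^ (2 * N) * (sqrt 2 * a) ^ (2 * l)"
        by (simp add: Suc flip: power_add)
      moreover have "u * A / B * C / D - E / B * (v * s * F) / D = (u * A * C - v * s * (E * F)) / (B * D)"
        for u A B C D E v s F :: real by (simp add: field_simps diff_divide_distrib)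
      ultimately have "?d l = ((2 * real N + 1) * sqrt 2 * (sqrt 2 * a) ^ (2 * N) * (sqrt 2 * a) ^ (2 * l)
          - 2 * real l * sqrt 2 * ((sqrt 2 * a) ^ (2 * N) * (sqrt 2 * a) ^ (2 * l))) / (real (dfact (2*N+1)) * real (dfact (2*l)))"
        by (metis (no_types))
      thus ?thesis by (simp add: algebra_simps)
    qed
    also have "\<dots> = sqrt 2 * (half_term N y / (2 * real N + 1) * ((2 * real N + 1 - 2 * real l) * (y ^ l / fact l)))"
    proof -
      have p: "pochhammer (1/2) N > (0::real)" by (rule pochhammer_pos) simp
      show ?thesis
        unfolding sq dfact_odd dfact_even half_term_def
        using p by (simp add: pochhammer_Suc power_mult_distrib divide_simps)
    qed
    finally show ?thesis .
  qed
  have "((\<lambda>x. kappa (Suc N) x a) has_real_derivative kernel_slope N y + sqrt 2 * (\<Sum>l\<le>N. ?d l)) (at a)"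
  proof -
    have pw: "((\<lambda>x. (sqrt 2 * x) ^ n) has_real_derivative (real n * sqrt 2 * (sqrt 2 * a) ^ (n - 1))) (at a)" for n
      by (rule derivative_eq_intros refl | simp)+
    show ?thesis
      unfolding kappa_Suc
      using pw[of "2 * N + 1"] pw[of "2 * l" for l]
      by (intro DERIV_add DERIV_cmult DERIV_sum DERIV_diff DERIV_cdivide DERIV_cmult_right Suc.IH[folded y_def])
         (simp_all add: algebra_simps)
  qed
  also have "kernel_slope N y + sqrt 2 * (\<Sum>l\<le>N. ?d l) = kernel_slope (Suc N) y"
    unfolding d kernel_slope_Suc sum_weighted_exp_poly[symmetric]
    by (simp add: s2 sum_distrib_left mult.assoc) (simp add: algebra_simps)
  finally show ?case by (simp add: y_def)
qed

text \<open>Only the derivative of \<open>kappa\<close> survives: the derivative of the exponential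
  prefactor is multiplied by \<open>kappa\<close> on the diagonal, which is zero.\<close>

lemma deriv_kappa_hat: "deriv (\<lambda>x. kappa_hat N x a) a = exp (-2 * a\<^sup>2) * kernel_slope N (a\<^sup>2)"
proof -
  have "((\<lambda>x. kappa_hat N x a) has_real_derivative exp (-2 * a\<^sup>2) * kernel_slope N (a\<^sup>2)) (at a)"
    unfolding kappa_hat_def
    by (rule derivative_eq_intros kappa_has_derivative refl | simp add: kappa_diag power2_eq_square)+
  thus ?thesis by (rule DERIV_imp_deriv)
qed

section \<open>Gaussian moments in the complex plane\<close>

lemma measurable_Complex_pair: "(\<lambda>(x, y). Complex x y) \<in> borel_measurable (lborel \<Otimes>\<^sub>M lborel)"
  unfolding Complex_eq by measurable

text \<open>A Borel measure that gives every box its volume is Lebesgue measure, so measuring the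
  preimages of boxes is enough.\<close>

lemma lborel_complex:
  "(lborel :: complex measure) = distr (lborel \<Otimes>\<^sub>M lborel) borel (\<lambda>(x, y). Complex x y)"
proof (rule lborel_eqI)
  fix l u :: complex
  assume *: "\<And>b. b \<in> Basis \<Longrightarrow> l \<bullet> b \<le> u \<bullet> b"
  have le: "Re l \<le> Re u" "Im l \<le> Im u"
    using *[of 1] *[of \<i>] by (simp_all add: Basis_complex_def)
  have "(\<lambda>(x, y). Complex x y) -` box l u \<inter> space (lborel \<Otimes>\<^sub>M lborel)
      = {Re l<..<Re u} \<times> {Im l<..<Im u}"
    by (auto simp: box_def Basis_complex_def space_pair_measure)
  hence "emeasure (distr (lborel \<Otimes>\<^sub>M lborel) borel (\<lambda>(x, y). Complex x y)) (box l u)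
      = emeasure (lborel \<Otimes>\<^sub>M lborel) ({Re l<..<Re u} \<times> {Im l<..<Im u})"
    using measurable_Complex_pair by (subst emeasure_distr) auto
  also have "\<dots> = ennreal (Re u - Re l) * ennreal (Im u - Im l)"
    using le by (subst lborel.emeasure_pair_measure_Times) auto
  also have "\<dots> = ennreal (\<Prod>b\<in>Basis. (u - l) \<bullet> b)"
    using le by (simp add: Basis_complex_def ennreal_mult)
  finally show "emeasure (distr (lborel \<Otimes>\<^sub>M lborel) borel (\<lambda>(x, y). Complex x y)) (box l u)
      = ennreal (\<Prod>b\<in>Basis. (u - l) \<bullet> b)" .
qed simp

lemma integrable_complex_iff:
  fixes f :: "complex \<Rightarrow> 'a::{banach, second_countable_topology}"
  assumes "f \<in> borel_measurable borel"
  shows "integrable lborel f \<longleftrightarrow> integrable (lborel \<Otimes>\<^sub>M lborel) (\<lambda>(x, y). f (Complex x y))"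
  unfolding lborel_complex using assms
  by (subst integrable_distr_eq[OF measurable_Complex_pair]) (simp_all add: case_prod_beta')

text \<open>Both orders are recorded because integration by parts in the real direction needs the
  inner integral over \<open>x\<close>, and in the imaginary direction over
  \<open>y\<close>.\<close>

lemma integral_complex_iterated:
  fixes f :: "complex \<Rightarrow> 'a::{banach, second_countable_topology}"
  assumes f: "integrable lborel f"
  shows "(LINT z|lborel. f z) = (LINT x|lborel. LINT y|lborel. f (Complex x y))"
    and "(LINT z|lborel. f z) = (LINT y|lborel. LINT x|lborel. f (Complex x y))"
proof -
  have m: "f \<in> borel_measurable borel" using f by auto
  have i: "integrable (lborel \<Otimes>\<^sub>M lborel) (\<lambda>(x, y). f (Complex x y))"
    using f integrable_complex_iff[OF m] by simp
  have "(LINT z|lborel. f z) = (LINT p|(lborel \<Otimes>\<^sub>M lborel). (case p of (x, y) \<Rightarrow> f (Complex x y)))"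
    unfolding lborel_complex using m
    by (subst integral_distr[OF measurable_Complex_pair]) (simp_all add: case_prod_beta')
  thus "(LINT z|lborel. f z) = (LINT x|lborel. LINT y|lborel. f (Complex x y))"
    "(LINT z|lborel. f z) = (LINT y|lborel. LINT x|lborel. f (Complex x y))"
    using lborel_pair.integral_fst'[OF i] lborel_pair.integral_snd[OF i] by simp_all
qed

lemma integral_exp_minus_square:
  fixes c :: real assumes "c > 0"
  shows "integrable lborel (\<lambda>x. exp (- c * x\<^sup>2))" "(LINT x|lborel. exp (- c * x\<^sup>2)) = sqrt (pi / c)"
proof -
  define s where "s = sqrt (1 / (2 * c))"
  have s: "s > 0" "s\<^sup>2 = 1 / (2 * c)" using assms by (simp_all add: s_def)
  have eq: "exp (- c * x\<^sup>2) = sqrt (pi / c) * normal_density 0 s x" for x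
  proof -
    have "2 * pi * s\<^sup>2 = pi / c" "(x - 0)\<^sup>2 / (2 * s\<^sup>2) = c * x\<^sup>2" using assms s(2) by simp_all
    thus ?thesis using assms by (simp add: normal_density_def)
  qed
  show "integrable lborel (\<lambda>x. exp (- c * x\<^sup>2))"
    unfolding eq using s by (intro integrable_mult_right integrable_normal_density)
  show "(LINT x|lborel. exp (- c * x\<^sup>2)) = sqrt (pi / c)"
    unfolding eq using s by (simp add: integral_normal_density)
qed

lemma exp_minus_cmod_square_Complex:
  "exp (- c * (cmod (Complex x y))\<^sup>2) = exp (- c * x\<^sup>2) * exp (- c * y\<^sup>2)"
  by (simp add: cmod_power2 algebra_simps flip: exp_add)

lemma integral_exp_minus_cmod_square:
  fixes c :: real assumes c: "c > 0"
  shows "integrable lborel (\<lambda>z::complex. exp (- c * (cmod z)\<^sup>2))"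
    and "(LINT z|lborel. exp (- c * (cmod z)\<^sup>2)) = pi / c"
proof -
  note I = integral_exp_minus_square[OF c]
  have "integrable (lborel \<Otimes>\<^sub>M lborel) (\<lambda>(x, y). exp (- c * x\<^sup>2) * exp (- c * y\<^sup>2))"
    by (rule lborel_pair.Fubini_integrable)
       (use I in \<open>simp_all\<close>)
  thus i: "integrable lborel (\<lambda>z::complex. exp (- c * (cmod z)\<^sup>2))"
    unfolding exp_minus_cmod_square_Complex[symmetric] by (subst integrable_complex_iff) auto
  show "(LINT z|lborel. exp (- c * (cmod z)\<^sup>2)) = pi / c"
    unfolding integral_complex_iterated(1)[OF i] exp_minus_cmod_square_Complex
    using I(2) c by (simp add: real_sqrt_mult_self)
qed

lemma power_le_fact_exp: "0 \<le> t \<Longrightarrow> t ^ m \<le> fact m * exp t" for t :: real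
proof -
  assume t: "0 \<le> t"
  have "(\<Sum>n\<in>{m}. t ^ n /\<^sub>R fact n) \<le> (\<Sum>n. t ^ n /\<^sub>R fact n)"
    using t summable_exp_generic[of t] by (intro sum_le_suminf) auto
  thus ?thesis by (simp add: exp_def field_simps)
qed

definition gauss_monom :: "nat \<Rightarrow> nat \<Rightarrow> complex \<Rightarrow> complex" where
  "gauss_monom i k z = z ^ i * cnj z ^ k * of_real (exp (-2 * (cmod z)\<^sup>2))"

text \<open>From \<open>t^m \<le> m! e^t\<close> and
  \<open>t - 2 t\<^sup>2 \<le> 1 - t\<^sup>2\<close>: half of the Gaussian is spent on absorbing the
  monomial.\<close>

lemma gauss_monom_bound: "norm (gauss_monom i k z) \<le> fact (i + k) * exp 1 * exp (- 1 * (cmod z)\<^sup>2)"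
proof -
  let ?t = "cmod z"
  have "norm (gauss_monom i k z) = ?t ^ (i + k) * exp (-2 * ?t\<^sup>2)"
    by (simp add: gauss_monom_def norm_mult norm_power power_add)
  also have "\<dots> \<le> fact (i + k) * exp ?t * exp (-2 * ?t\<^sup>2)"
    by (intro mult_right_mono power_le_fact_exp) auto
  also have "\<dots> = fact (i + k) * exp (?t - 2 * ?t\<^sup>2)"
    by (simp add: exp_diff exp_minus field_simps)
  also have "\<dots> \<le> fact (i + k) * exp (1 - 1 * ?t\<^sup>2)"
  proof -
    have "0 \<le> (?t - 1/2)\<^sup>2" by simp
    hence "?t - 2 * ?t\<^sup>2 \<le> 1 - 1 * ?t\<^sup>2" by (simp add: power2_diff power_divide)
    thus ?thesis by (intro mult_left_mono) auto
  qed
  also have "\<dots> = fact (i + k) * exp 1 * exp (- 1 * ?t\<^sup>2)"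
    by (simp add: exp_diff exp_minus field_simps)
  finally show ?thesis .
qed

lemma continuous_gauss_monom [continuous_intros]:
  "continuous_on A f \<Longrightarrow> continuous_on A (\<lambda>x. gauss_monom i k (f x))"
  unfolding gauss_monom_def by (intro continuous_intros)

lemma gauss_monom_borel [measurable]: "gauss_monom i k \<in> borel_measurable borel"
  by (rule borel_measurable_continuous_onI) (intro continuous_intros)

lemma integrable_gauss_monom: "integrable lborel (gauss_monom i k)"
proof (rule Bochner_Integration.integrable_bound)
  show "integrable lborel (\<lambda>z::complex. fact (i + k) * exp 1 * exp (- 1 * (cmod z)\<^sup>2))"
    by (intro integrable_mult_right integral_exp_minus_cmod_square) simp
  show "AE z in lborel. norm (gauss_monom i k z) \<le> norm (fact (i + k) * exp 1 * exp (- 1 * (cmod z)\<^sup>2))"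
    by (rule AE_I2, rule order.trans[OF gauss_monom_bound]) simp
qed simp

text \<open>Meant for horizontal and vertical lines, on which the modulus is at least the running
  coordinate; the bound does not depend on the offset of the line.\<close>

lemma gauss_monom_bound_line:
  assumes "\<And>x. cmod (f x) \<ge> \<bar>x\<bar>"
  shows "norm (gauss_monom i k (f x)) \<le> fact (i + k) * exp 1 * exp (- 1 * x\<^sup>2)"
proof -
  have "x\<^sup>2 \<le> (cmod (f x))\<^sup>2" using assms[of x] by (metis power2_abs abs_ge_zero power_mono)
  hence "fact (i + k) * exp 1 * exp (- 1 * (cmod (f x))\<^sup>2) \<le> fact (i + k) * exp 1 * exp (- 1 * x\<^sup>2)"
    by (intro mult_left_mono) auto
  thus ?thesis using gauss_monom_bound[of i k "f x"] by linarith
qed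

lemma integrable_gauss_monom_line:
  assumes "continuous_on UNIV f" "\<And>x. cmod (f x) \<ge> \<bar>x\<bar>"
  shows "integrable lborel (\<lambda>x. gauss_monom i k (f x))"
proof (rule Bochner_Integration.integrable_bound)
  show "integrable lborel (\<lambda>x::real. fact (i + k) * exp 1 * exp (- 1 * x\<^sup>2))"
    by (intro integrable_mult_right integral_exp_minus_square) simp
  show "AE x in lborel. norm (gauss_monom i k (f x)) \<le> norm (fact (i + k) * exp 1 * exp (- 1 * x\<^sup>2))"
    by (rule AE_I2, rule order.trans[OF gauss_monom_bound_line[OF assms(2)]]) simp
qed (use assms(1) in \<open>auto intro!: borel_measurable_continuous_onI continuous_intros\<close>)

lemma gauss_monom_line_tendsto_0:
  assumes "\<And>x. cmod (f x) \<ge> \<bar>x\<bar>"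
  shows "((\<lambda>x. gauss_monom i k (f x)) \<longlongrightarrow> 0) at_top" "((\<lambda>x. gauss_monom i k (f x)) \<longlongrightarrow> 0) at_bot"
proof -
  have b: "\<forall>x. norm (gauss_monom i k (f x)) \<le> fact (i + k) * exp 1 * exp (- 1 * x\<^sup>2)"
    using gauss_monom_bound_line[OF assms] by blast
  have e: "((\<lambda>x::real. exp (- 1 * x\<^sup>2)) \<longlongrightarrow> 0) F" if "filterlim (\<lambda>x::real. x\<^sup>2) at_top F" for F
    using that by (auto intro!: filterlim_compose[OF exp_at_bot] simp: filterlim_uminus_at_top)
  have "((\<lambda>x::real. fact (i + k) * exp 1 * exp (- 1 * x\<^sup>2)) \<longlongrightarrow> 0) at_top"
    "((\<lambda>x::real. fact (i + k) * exp 1 * exp (- 1 * x\<^sup>2)) \<longlongrightarrow> 0) at_bot"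
    by (rule tendsto_mult_right_zero, rule e, simp add: filterlim_pow_at_top filterlim_pow_at_bot_even filterlim_ident)+
  thus "((\<lambda>x. gauss_monom i k (f x)) \<longlongrightarrow> 0) at_top" "((\<lambda>x. gauss_monom i k (f x)) \<longlongrightarrow> 0) at_bot"
    by (auto intro!: Lim_null_comparison[OF always_eventually[OF b]])
qed

section \<open>Integration by parts and the moment recursion\<close>

lemma integral_derivative_eq_0:
  fixes f f' :: "real \<Rightarrow> complex"
  assumes "\<And>x. (f has_vector_derivative f' x) (at x)" "continuous_on UNIV f'" "integrable lborel f'"
    and "(f \<longlongrightarrow> 0) at_top" "(f \<longlongrightarrow> 0) at_bot"
  shows "(LINT x|lborel. f' x) = 0"
proof -
  have "(LBINT x=-\<infinity>..\<infinity>. f' x) = 0 - 0"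
    using assms
    by (intro interval_integral_FTC_integrable[where F = f])
       (auto simp: continuous_on_eq_continuous_at set_integrable_def einterval_def ereal_tendsto_simps)
  thus ?thesis
    by (simp add: interval_lebesgue_integral_def einterval_def set_lebesgue_integral_def)
qed

lemma gauss_monom_Suc:
  "gauss_monom (Suc i) k z = z * gauss_monom i k z" "gauss_monom i (Suc k) z = cnj z * gauss_monom i k z"
  by (simp_all add: gauss_monom_def)

lemma Complex_has_vector_derivative:
  "((\<lambda>x. Complex x y) has_vector_derivative 1) (at x)"
  "((\<lambda>y. Complex x y) has_vector_derivative \<i>) (at y)"
  unfolding Complex_eq has_vector_derivative_def
  by (auto intro!: derivative_eq_intros simp: scaleR_conv_of_real fun_eq_iff)

text \<open>Written without \<open>cmod\<close>, purely in \<open>z\<close> and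
  \<open>cnj z\<close>, the function can be differentiated by the product rule.\<close>

lemma gauss_monom_alt: "gauss_monom i k z = z ^ i * cnj z ^ k * exp (-2 * (z * cnj z))"
  unfolding gauss_monom_def complex_norm_square[symmetric] by (simp flip: exp_of_real)

text \<open>Derivative along a path with velocity \<open>d\<close>, so that \<open>cnj z\<close>
  moves with velocity \<open>cnj d\<close>. The truncated exponents \<open>i - 1\<close> and
  \<open>k - 1\<close> come with the factors \<open>i\<close> and \<open>k\<close>.\<close>

definition gauss_monom_deriv :: "nat \<Rightarrow> nat \<Rightarrow> complex \<Rightarrow> complex \<Rightarrow> complex" where
  "gauss_monom_deriv i k d z = of_nat i * d * gauss_monom (i - 1) k z + of_nat k * cnj d * gauss_monom i (k - 1) z
     - 2 * d * gauss_monom i (Suc k) z - 2 * cnj d * gauss_monom (Suc i) k z"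

lemma gauss_monom_has_vector_derivative:
  assumes "(f has_vector_derivative d) (at x)"
  shows "((\<lambda>x. gauss_monom i k (f x)) has_vector_derivative gauss_monom_deriv i k d (f x)) (at x)"
proof -
  have f: "(f has_derivative (\<lambda>h. h *\<^sub>R d)) (at x)"
    using assms by (simp add: has_vector_derivative_def)
  have c: "((\<lambda>x. cnj (f x)) has_derivative (\<lambda>h. h *\<^sub>R cnj d)) (at x)"
    using bounded_linear.has_derivative[OF bounded_linear_cnj f] by (simp add: complex_cnj_scaleR)
  have "((\<lambda>x. -2 * (f x * cnj (f x))) has_vector_derivative -2 * (d * cnj (f x) + f x * cnj d)) (at x)"
    unfolding has_vector_derivative_def
    by (rule derivative_eq_intros f c refl | simp)+
       (simp add: scaleR_conv_of_real fun_eq_iff algebra_simps)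
  from field_vector_diff_chain_at[OF this DERIV_exp]
  have e: "((\<lambda>x. exp (-2 * (f x * cnj (f x)))) has_derivative
      (\<lambda>h. h *\<^sub>R (-2 * (d * cnj (f x) + f x * cnj d) * exp (-2 * (f x * cnj (f x)))))) (at x)"
    by (simp add: has_vector_derivative_def o_def)
  have "((\<lambda>x. f x ^ i * cnj (f x) ^ k * exp (-2 * (f x * cnj (f x)))) has_derivative
      (\<lambda>h. h *\<^sub>R gauss_monom_deriv i k d (f x))) (at x)"
    by (rule has_derivative_eq_rhs, rule has_derivative_mult[OF has_derivative_mult[OF
          has_derivative_power[OF f] has_derivative_power[OF c]] e])
       (simp add: gauss_monom_deriv_def gauss_monom_alt scaleR_conv_of_real fun_eq_iff algebra_simps)
  thus ?thesis
    unfolding gauss_monom_alt has_vector_derivative_def .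
qed

lemma integral_gauss_monom_deriv_line:
  assumes f: "\<And>x. (f has_vector_derivative d) (at x)" and le: "\<And>x. cmod (f x) \<ge> \<bar>x\<bar>"
  shows "(LINT x|lborel. gauss_monom_deriv i k d (f x)) = 0"
proof (rule integral_derivative_eq_0)
  have c: "continuous_on UNIV f"
    using f by (intro continuous_at_imp_continuous_on ballI has_vector_derivative_continuous)
  show "((\<lambda>x. gauss_monom i k (f x)) has_vector_derivative gauss_monom_deriv i k d (f x)) (at x)" for x
    by (rule gauss_monom_has_vector_derivative[OF f])
  show "continuous_on UNIV (\<lambda>x. gauss_monom_deriv i k d (f x))"
    unfolding gauss_monom_deriv_def by (intro continuous_intros c)
  show "integrable lborel (\<lambda>x. gauss_monom_deriv i k d (f x))"
    unfolding gauss_monom_deriv_def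
    by (intro Bochner_Integration.integrable_add Bochner_Integration.integrable_diff integrable_mult_right
        integrable_gauss_monom_line c le)
qed (rule gauss_monom_line_tendsto_0[OF le])+

lemma integrable_gauss_monom_deriv: "integrable lborel (gauss_monom_deriv i k d)"
  unfolding gauss_monom_deriv_def[abs_def]
  by (intro Bochner_Integration.integrable_add Bochner_Integration.integrable_diff integrable_mult_right
        integrable_gauss_monom)

text \<open>The derivative along \<open>1\<close> plus \<i> times the derivative along \<i> is twice
  the Wirtinger derivative in \<open>cnj z\<close>, which treats \<open>z^i\<close> as a constant.
  Both directional derivatives integrate to zero.\<close>

lemma gauss_moment_rec:
  "2 * (LINT z|lborel. gauss_monom (Suc i) k z) = of_nat k * (LINT z|lborel. gauss_monom i (k - 1) z)"
proof -
  have "(LINT z|lborel. gauss_monom_deriv i k 1 z) = 0"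
    unfolding integral_complex_iterated(2)[OF integrable_gauss_monom_deriv]
    by (subst integral_gauss_monom_deriv_line) (auto simp: Complex_has_vector_derivative abs_Re_le_cmod[of "Complex _ _", simplified])
  moreover have "(LINT z|lborel. gauss_monom_deriv i k \<i> z) = 0"
    unfolding integral_complex_iterated(1)[OF integrable_gauss_monom_deriv]
    by (subst integral_gauss_monom_deriv_line) (auto simp: Complex_has_vector_derivative abs_Im_le_cmod[of "Complex _ _", simplified])
  ultimately have "(LINT z|lborel. gauss_monom_deriv i k 1 z + \<i> * gauss_monom_deriv i k \<i> z) = 0"
    by (simp add: integrable_gauss_monom_deriv)
  also have "(\<lambda>z. gauss_monom_deriv i k 1 z + \<i> * gauss_monom_deriv i k \<i> z)
      = (\<lambda>z. 2 * of_nat k * gauss_monom i (k - 1) z - 4 * gauss_monom (Suc i) k z)"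
    by (auto simp: gauss_monom_deriv_def algebra_simps fun_eq_iff)
  finally show ?thesis
    by (simp add: integrable_gauss_monom)
qed

lemma gauss_moment:
  "(LINT z|lborel. gauss_monom i k z) = (if i = k then of_real (pi * fact k / 2 ^ (k + 1)) else 0)"
proof (induction i arbitrary: k)
  case 0
  show ?case
  proof (cases k)
    case 0
    have "(LINT z|lborel. gauss_monom 0 0 z) = of_real (LINT z::complex|lborel. exp (-2 * (cmod z)\<^sup>2))"
      by (simp add: gauss_monom_def)
    also have "(LINT z::complex|lborel. exp (-2 * (cmod z)\<^sup>2)) = pi / 2"
      by (rule integral_exp_minus_cmod_square(2)) simp
    finally show ?thesis using 0 by simp
  next
    case (Suc k')
    \<comment> \<open>The recursion needs a positive first exponent; conjugation moves the positive
      exponent there.\<close>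
    have "(LINT z|lborel. gauss_monom 0 k z) = cnj (LINT z|lborel. gauss_monom k 0 z)"
    proof -
      have "gauss_monom 0 k = (\<lambda>z. cnj (gauss_monom k 0 z))" by (simp add: gauss_monom_def fun_eq_iff)
      thus ?thesis by simp
    qed
    also have "(LINT z|lborel. gauss_monom k 0 z) = 0"
      using gauss_moment_rec[of k' 0] Suc by simp
    finally show ?thesis using Suc by simp
  qed
next
  case (Suc i)
  have "(LINT z|lborel. gauss_monom (Suc i) k z) = of_nat k / 2 * (LINT z|lborel. gauss_monom i (k - 1) z)"
    using gauss_moment_rec[of i k] by (simp add: field_simps)
  thus ?case using Suc.IH[of "k - 1"] by (cases k) (auto simp: field_simps)
qed

section \<open>The skew-symmetric form and its orthogonal polynomials\<close>

text \<open>Of \<open>|w - cnj w|\<^sup>2 = (cnj w - w) * (w - cnj w)\<close> one factor goes into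
  the Vandermonde product and the other is kept here, which makes the weight odd under conjugation.
  The factor \<open>|w - a|\<^sup>2\<close> of \<open>omega_over\<close> goes into the Vandermonde
  product as well.\<close>

definition pre_weight :: "real \<Rightarrow> complex \<Rightarrow> complex" where
  "pre_weight a z = (z - cnj z) * of_real ((1 + (cmod (z - of_real a))\<^sup>2) * exp (-2 * (cmod z)\<^sup>2) / pi)"

text \<open>Half of the customary pairing that antisymmetrises in \<open>f\<close> and
  \<open>g\<close>; the oddness of the weight already makes it antisymmetric. The factor 2 reappears
  in \<open>sum_pairing_permutations\<close>.\<close>

definition skew_form :: "real \<Rightarrow> complex poly \<Rightarrow> complex poly \<Rightarrow> complex" where
  "skew_form a f g = (LINT z|lborel. poly f z * poly g (cnj z) * pre_weight a z)"

definition skew_moment :: "real \<Rightarrow> nat \<Rightarrow> nat \<Rightarrow> real" where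
  "skew_moment a i k =
     (if k = i + 1 then fact k / 2 ^ (k + 1) * (1 + a\<^sup>2 + (real k + 1) / 2)
      else if i = k + 1 then - (fact i / 2 ^ (i + 1) * (1 + a\<^sup>2 + (real i + 1) / 2))
      else if k = i + 2 then - a * fact k / 2 ^ (k + 1)
      else if i = k + 2 then a * fact i / 2 ^ (i + 1)
      else 0)"

text \<open>In \<open>(z - cnj z) * (1 + |z - a|\<^sup>2)\<close> the terms linear in
  \<open>a\<close> combine to \<open>- a * (z\<^sup>2 - (cnj z)\<^sup>2)\<close>, the mixed ones
  cancelling. Hence a moment can be nonzero only if \<open>i\<close> and \<open>k\<close> differ by
  one or two, the pattern of \<open>skew_moment\<close>.\<close>

lemma pre_weight_monom:
  "z ^ i * cnj z ^ k * pre_weight a z = of_real (1 / pi) *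
     ((1 + of_real a ^ 2) * (gauss_monom (Suc i) k z - gauss_monom i (Suc k) z)
      + gauss_monom (Suc (Suc i)) (Suc k) z - gauss_monom (Suc i) (Suc (Suc k)) z
      - of_real a * gauss_monom (Suc (Suc i)) k z + of_real a * gauss_monom i (Suc (Suc k)) z)"
proof -
  have "complex_of_real ((cmod (z - of_real a))\<^sup>2) = (z - of_real a) * (cnj z - of_real a)"
    by (simp only: complex_norm_square) simp
  hence "z ^ i * cnj z ^ k * pre_weight a z
      = (z - cnj z) * (1 + (z - of_real a) * (cnj z - of_real a)) * gauss_monom i k z * of_real (1 / pi)"
    unfolding pre_weight_def gauss_monom_def by simp
  moreover have "(x - y) * (1 + (x - b) * (y - b)) * G * c = c * ((1 + b ^ 2) * (x * G - y * G)
      + y * (x * (x * G)) - y * (y * (x * G)) - b * (x * (x * G)) + b * (y * (y * G)))" for x y b G c :: complex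
    by (simp add: algebra_simps power2_eq_square)
  ultimately show ?thesis by (simp only: gauss_monom_Suc)
qed

lemma integrable_pre_weight_monom: "integrable lborel (\<lambda>z. z ^ i * cnj z ^ k * pre_weight a z)"
  unfolding pre_weight_monom
  by (intro Bochner_Integration.integrable_add Bochner_Integration.integrable_diff integrable_mult_right
        integrable_gauss_monom)

lemma integral_pre_weight_monom:
  "(LINT z|lborel. z ^ i * cnj z ^ k * pre_weight a z) = of_real (skew_moment a i k)"
proof -
  have "(LINT z|lborel. z ^ i * cnj z ^ k * pre_weight a z) = of_real (1 / pi) *
     ((1 + of_real a ^ 2) * ((LINT z|lborel. gauss_monom (Suc i) k z) - (LINT z|lborel. gauss_monom i (Suc k) z))
      + (LINT z|lborel. gauss_monom (Suc (Suc i)) (Suc k) z) - (LINT z|lborel. gauss_monom (Suc i) (Suc (Suc k)) z)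
      - of_real a * (LINT z|lborel. gauss_monom (Suc (Suc i)) k z)
      + of_real a * (LINT z|lborel. gauss_monom i (Suc (Suc k)) z))"
    unfolding pre_weight_monom
    by (simp add: integrable_gauss_monom)
  also have "\<dots> = of_real (skew_moment a i k)"
  proof -
    consider "k = i + 1" | "i = k + 1" | "k = i + 2" | "i = k + 2"
      | "k \<noteq> i + 1" "i \<noteq> k + 1" "k \<noteq> i + 2" "i \<noteq> k + 2" by blast
    thus ?thesis
      by cases (simp_all add: gauss_moment skew_moment_def field_simps)
  qed
  finally show ?thesis .
qed

lemma skew_integrand_expand:
  "poly f z * poly g (cnj z) * pre_weight a z
     = (\<Sum>i\<le>degree f. \<Sum>k\<le>degree g. coeff f i * coeff g k * (z ^ i * cnj z ^ k * pre_weight a z))"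
  unfolding poly_altdef[of f] poly_altdef[of g] sum_product unfolding sum_distrib_right
  by (intro sum.cong refl) (simp only: mult_ac)

lemma integrable_skew: "integrable lborel (\<lambda>z. poly f z * poly g (cnj z) * pre_weight a z)"
  unfolding skew_integrand_expand
  by (intro Bochner_Integration.integrable_sum integrable_mult_right integrable_pre_weight_monom)

lemma skew_form_expand:
  "skew_form a f g = (\<Sum>i\<le>degree f. \<Sum>k\<le>degree g. coeff f i * coeff g k * of_real (skew_moment a i k))"
  unfolding skew_form_def skew_integrand_expand
  by (simp add: Bochner_Integration.integral_sum Bochner_Integration.integrable_sum
      integrable_pre_weight_monom integral_pre_weight_monom)

lemma skew_form_linear:
  "skew_form a (f + g) h = skew_form a f h + skew_form a g h"
  "skew_form a (Polynomial.smult c f) h = c * skew_form a f h"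
  "skew_form a h (f + g) = skew_form a h f + skew_form a h g"
  "skew_form a h (Polynomial.smult c f) = c * skew_form a h f"
proof -
  have "(\<lambda>z. poly (f + g) z * poly h (cnj z) * pre_weight a z)
      = (\<lambda>z. poly f z * poly h (cnj z) * pre_weight a z + poly g z * poly h (cnj z) * pre_weight a z)"
    by (simp add: algebra_simps)
  thus "skew_form a (f + g) h = skew_form a f h + skew_form a g h"
    by (simp add: skew_form_def integrable_skew)
  have "(\<lambda>z. poly h z * poly (f + g) (cnj z) * pre_weight a z)
      = (\<lambda>z. poly h z * poly f (cnj z) * pre_weight a z + poly h z * poly g (cnj z) * pre_weight a z)"
    by (simp add: algebra_simps)
  thus "skew_form a h (f + g) = skew_form a h f + skew_form a h g"
    by (simp add: skew_form_def integrable_skew)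
  show "skew_form a (Polynomial.smult c f) h = c * skew_form a f h" "skew_form a h (Polynomial.smult c f) = c * skew_form a h f"
    unfolding skew_form_def by (simp_all add: mult_ac flip: Bochner_Integration.integral_mult_right_zero)
qed

lemma skew_form_antisym: "skew_form a g f = - skew_form a f g"
proof -
  have m: "skew_moment a k i = - skew_moment a i k" for i k
    by (auto simp: skew_moment_def)
  show ?thesis
    unfolding skew_form_expand sum_negf[symmetric]
  proof (subst sum.swap, intro sum.cong refl)
    fix i k
    show "coeff g k * coeff f i * complex_of_real (skew_moment a k i)
        = - (coeff f i * coeff g k * complex_of_real (skew_moment a i k))"
      by (subst m) simp
  qed
qed

lemma skew_form_self: "skew_form a f f = 0"
  using skew_form_antisym[of a f f] by simp

text \<open>The band structure at work: paired with polynomials of lower degree, a monomial sees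
  only the two highest possible coefficients.\<close>

lemma skew_form_monom_left:
  assumes "degree f \<le> m + 1"
  shows "skew_form a (monom 1 (m + 2)) f
    = of_real (skew_moment a (m + 2) (m + 1)) * coeff f (m + 1) + of_real (skew_moment a (m + 2) m) * coeff f m"
proof -
  let ?t = "\<lambda>k. coeff f k * of_real (skew_moment a (m + 2) k)"
  have "skew_form a (monom 1 (m + 2)) f = (\<Sum>k\<le>degree f. ?t k)"
  proof -
    have "(\<Sum>i\<le>m + 2. \<Sum>k\<le>degree f. coeff (monom 1 (m + 2)) i * coeff f k * of_real (skew_moment a i k))
        = (\<Sum>i\<in>{m + 2}. \<Sum>k\<le>degree f. coeff (monom 1 (m + 2)) i * coeff f k * of_real (skew_moment a i k))"
      by (rule sum.mono_neutral_right) auto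
    thus ?thesis by (simp add: skew_form_expand degree_monom_eq)
  qed
  also have "\<dots> = (\<Sum>k\<le>m + 1. ?t k)"
    using assms by (intro sum.mono_neutral_left) (auto simp: coeff_eq_0)
  also have "\<dots> = (\<Sum>k\<in>{m, m + 1}. ?t k)"
    by (rule sum.mono_neutral_right) (auto simp: skew_moment_def)
  finally show ?thesis by (simp add: mult.commute)
qed

lemma skew_form_monom: "skew_form a (monom 1 i) (monom 1 k) = of_real (skew_moment a i k)"
  by (simp add: skew_form_def poly_monom integral_pre_weight_monom)

text \<open>Equals \<open>n!\<close> times the sum of \<open>exp_poly m y\<close> over
  \<open>m \<le> n\<close>, which explains its positivity. It is chosen as the solution of
  \<open>pre_norm_rec\<close> in terms of which the skew norms become quotients.\<close>

definition pre_norm :: "nat \<Rightarrow> real \<Rightarrow> real" where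
  "pre_norm n y = fact n * ((real n + 1 - y) * exp_poly n y + y * (y ^ n / fact n))"

lemma pre_norm_0 [simp]: "pre_norm 0 y = 1"
  by (simp add: pre_norm_def)

lemma pre_norm_1: "pre_norm (Suc 0) y = 2 + y"
  by (simp add: pre_norm_def exp_poly_Suc algebra_simps)

lemma pre_norm_pos: "y \<ge> 0 \<Longrightarrow> pre_norm n y > 0"
proof -
  assume y: "y \<ge> 0"
  have "(real n + 1 - y) * exp_poly n y + y * (y ^ n / fact n) > 0"
  proof (induction n)
    case (Suc n)
    have "(real (Suc n) + 1 - y) * exp_poly (Suc n) y + y * (y ^ Suc n / fact (Suc n))
        = (real n + 1 - y) * exp_poly n y + y * (y ^ n / fact n) + exp_poly (Suc n) y"
      by (simp add: exp_poly_Suc divide_simps) (simp add: algebra_simps)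
    moreover have "exp_poly (Suc n) y \<ge> 0" unfolding exp_poly_def using y by (intro sum_nonneg) simp
    ultimately show ?case using Suc.IH by linarith
  qed simp
  thus ?thesis by (simp add: pre_norm_def)
qed

text \<open>Linear form of the Riccati recursion that Gram-Schmidt imposes on the quotients
  \<open>pre_norm (Suc n) y / pre_norm n y\<close> inside the skew norms.\<close>

lemma pre_norm_rec:
  "pre_norm (Suc (Suc n)) y = (real n + 3 + y) * pre_norm (Suc n) y - y * (real n + 1) * pre_norm n y"
proof -
  define u where "u = y ^ n / fact n"
  define e where "e = exp_poly n y"
  have 1: "y ^ Suc n / fact (Suc n) = u * y / (real n + 1)"
    "y ^ Suc (Suc n) / fact (Suc (Suc n)) = u * y / (real n + 1) * y / (real n + 2)"
    by (simp_all add: u_def field_simps)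
  have 2: "exp_poly (Suc n) y = e + u * y / (real n + 1)"
    "exp_poly (Suc (Suc n)) y = e + u * y / (real n + 1) + u * y / (real n + 1) * y / (real n + 2)"
    by (simp_all add: exp_poly_Suc u_def e_def field_simps)
  have "real n + 1 > 0" "real n + 2 > 0" by simp_all
  thus ?thesis
    unfolding pre_norm_def 1 2 u_def[symmetric] e_def[symmetric]
    by (simp add: divide_simps) (simp add: algebra_simps)
qed

text \<open>Gram-Schmidt for a banded antisymmetric moment matrix: each new monomial is corrected by
  the preceding pair only. An odd monomial has zero pairing with the even member of that pair, so a
  multiple of this even member suffices to correct it.\<close>

function skew_op :: "real \<Rightarrow> nat \<Rightarrow> complex poly" where
  "skew_op a 0 = 1"
| "skew_op a (Suc 0) = monom 1 1"
| "skew_op a (Suc (Suc n)) = monom 1 (n + 2) +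
     (let k = real (n div 2) + 1; s = pre_norm (n div 2) (a\<^sup>2) / pre_norm (n div 2 + 1) (a\<^sup>2)
      in if even n
         then Polynomial.smult (of_real (a * k * s)) (skew_op a (Suc n)) + Polynomial.smult (of_real (k * (k + 3/2 + a\<^sup>2) * s)) (skew_op a n)
         else Polynomial.smult (of_real (- a * k * (k + 1/2) * s)) (skew_op a (n - 1)))"
  by pat_completeness auto
termination by (relation "Wellfounded.measure snd") auto

lemma skew_op_even:
  "skew_op a (2 * k + 2) = monom 1 (2 * k + 2)
     + Polynomial.smult (of_real (a * (real k + 1) * (pre_norm k (a\<^sup>2) / pre_norm (Suc k) (a\<^sup>2)))) (skew_op a (2 * k + 1))
     + Polynomial.smult (of_real ((real k + 1) * (real k + 1 + 3/2 + a\<^sup>2) * (pre_norm k (a\<^sup>2) / pre_norm (Suc k) (a\<^sup>2)))) (skew_op a (2 * k))"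
proof -
  have "skew_op a (2 * k + 2) = skew_op a (Suc (Suc (2 * k)))" by simp
  thus ?thesis by (simp only: skew_op.simps Let_def) simp
qed

lemma skew_op_odd:
  "skew_op a (2 * k + 3) = monom 1 (2 * k + 3)
     + Polynomial.smult (of_real (- a * (real k + 1) * (real k + 1 + 1/2) * (pre_norm k (a\<^sup>2) / pre_norm (Suc k) (a\<^sup>2)))) (skew_op a (2 * k))"
proof -
  have "skew_op a (2 * k + 3) = skew_op a (Suc (Suc (2 * k + 1)))" by (simp add: numeral_3_eq_3)
  also have "\<dots> = monom 1 (2 * k + 3)
     + Polynomial.smult (of_real (- a * (real k + 1) * (real k + 1 + 1/2) * (pre_norm k (a\<^sup>2) / pre_norm (Suc k) (a\<^sup>2)))) (skew_op a (2 * k))"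
    by (simp only: skew_op.simps Let_def) (simp add: numeral_3_eq_3)
  finally show ?thesis .
qed

declare skew_op.simps(3) [simp del]

lemma skew_op_monic: "degree (skew_op a n) = n \<and> coeff (skew_op a n) n = 1"
proof (induction n rule: less_induct)
  case (less n)
  have *: "degree (monom 1 n + r) = n \<and> coeff (monom 1 n + r) n = 1" if "degree r < n" for r :: "complex poly"
    using that by (simp add: degree_add_eq_left degree_monom_eq coeff_eq_0)
  consider "n = 0" | "n = 1" | k where "n = 2 * k + 2" | k where "n = 2 * k + 3"
  proof (cases "n < 2")
    case True thus ?thesis using that(1,2) by linarith
  next
    case False
    show ?thesis
    proof (cases "even n")
      case True
      then obtain m where "n = 2 * m" by blast
      thus ?thesis using False that(3)[of "m - 1"] by simp
    next
      case odd: False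
      then obtain m where "n = 2 * m + 1" by (blast elim: oddE)
      thus ?thesis using False that(4)[of "m - 1"] by simp
    qed
  qed
  thus ?case
  proof cases
    case 3
    show ?thesis unfolding 3 skew_op_even add.assoc
    proof (rule *[unfolded 3])
      have "degree (Polynomial.smult c (skew_op a (2 * k + 1))) < 2 * k + 2" "degree (Polynomial.smult d (skew_op a (2 * k))) < 2 * k + 2" for c d
        using less.IH[of "2 * k + 1"] less.IH[of "2 * k"] 3
          degree_smult_le[of c "skew_op a (2 * k + 1)"] degree_smult_le[of d "skew_op a (2 * k)"] by linarith+
      thus "degree (Polynomial.smult c (skew_op a (2 * k + 1)) + Polynomial.smult d (skew_op a (2 * k))) < 2 * k + 2" for c d
        by (rule degree_add_less)
    qed
  next
    case 4
    show ?thesis unfolding 4 skew_op_odd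
    proof (rule *[unfolded 4])
      show "degree (Polynomial.smult c (skew_op a (2 * k))) < 2 * k + 3" for c
        using less.IH[of "2 * k"] 4 degree_smult_le[of c "skew_op a (2 * k)"] by linarith
    qed
  qed (simp_all add: degree_monom_eq)
qed

lemma degree_skew_op: "degree (skew_op a n) = n" and lead_coeff_skew_op: "coeff (skew_op a n) n = 1"
  using skew_op_monic by blast+

text \<open>Orthogonality determines the odd polynomials only up to multiples of their even
  partners. This normalisation keeps the second off-diagonal moment out of the pairing of
  \<open>x^(2k+2)\<close> with \<open>skew_op a (2k + 1)\<close>.\<close>

lemma coeff_skew_op_odd: "coeff (skew_op a (2 * k + 1)) (2 * k) = 0"
proof (cases k)
  case (Suc j)
  have e: "2 * Suc j + 1 = 2 * j + 3" by simp
  show ?thesis unfolding Suc e skew_op_odd by (simp add: coeff_eq_0 degree_skew_op)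
qed simp

definition skew_norm :: "real \<Rightarrow> nat \<Rightarrow> real" where
  "skew_norm a k = fact (2 * k + 1) / 2 ^ (2 * k + 2) * (pre_norm (Suc k) (a\<^sup>2) / pre_norm k (a\<^sup>2))"

text \<open>Induction over pairs: the band structure and the induction hypothesis make the new pair
  orthogonal to all but the last pair, and the coefficients \<open>A\<close>, \<open>B\<close>,
  \<open>D\<close> remove what is left.\<close>

lemma skew_op_orthogonal:
  "(\<forall>i<2 * k + 2. \<forall>j<2 * k + 2. i div 2 \<noteq> j div 2 \<longrightarrow> skew_form a (skew_op a i) (skew_op a j) = 0)
    \<and> skew_form a (skew_op a (2 * k)) (skew_op a (2 * k + 1)) = of_real (skew_norm a k)"
proof (induction k)
  case 0
  have "skew_form a (skew_op a 0) (skew_op a 1) = of_real (skew_moment a 0 1)"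
    using skew_form_monom[of a 0 1] by simp
  thus ?case by (auto simp: skew_norm_def skew_moment_def pre_norm_1 field_simps less_2_cases_iff)
next
  case (Suc k)
  define y where "y = a\<^sup>2"
  define q where "q = skew_op a"
  define E0 E1 E2 where "E0 = pre_norm k y" and "E1 = pre_norm (Suc k) y" and "E2 = pre_norm (Suc (Suc k)) y"
  have y: "y \<ge> 0" by (simp add: y_def)
  have pos: "E0 > 0" "E1 > 0" using pre_norm_pos[OF y] by (simp_all add: E0_def E1_def)
  \<comment> \<open>Gram-Schmidt coefficients: the moments \<open>m2\<close>, \<open>- m1\<close>
    and \<open>- m3\<close> computed below, divided by \<open>skew_norm a k\<close>.\<close>
  define A B D where "A = a * (real k + 1) * (E0 / E1)" and "B = (real k + 1) * (real k + 5/2 + y) * (E0 / E1)"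
    and "D = - a * (real k + 1) * (real k + 3/2) * (E0 / E1)"
  have qe: "q (2 * k + 2) = monom 1 (2 * k + 2) + Polynomial.smult (of_real A) (q (2 * k + 1)) + Polynomial.smult (of_real B) (q (2 * k))"
    using skew_op_even[of a k] unfolding q_def A_def B_def E0_def E1_def y_def by (simp add: add.assoc)
  have qo: "q (2 * k + 3) = monom 1 (2 * k + 3) + Polynomial.smult (of_real D) (q (2 * k))"
    using skew_op_odd[of a k] unfolding q_def D_def E0_def E1_def y_def by (simp add: add.assoc)
  define h where "h = fact (2 * k + 1) / (2 ^ (2 * k + 2) :: real)"
  have h: "h > 0" by (simp add: h_def)
  have R: "skew_norm a k = h * E1 / E0" by (simp add: skew_norm_def h_def E0_def E1_def y_def)
  have f2: "fact (2 * k + 2) = (2 * real k + 2) * fact (2 * k + 1)"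
    "fact (2 * k + 3) = (2 * real k + 3) * ((2 * real k + 2) * fact (2 * k + 1))"
    by (simp_all add: algebra_simps numeral_eq_Suc)
  have m1: "skew_moment a (2 * k + 2) (2 * k + 1) = - ((real k + 1) * h * (real k + 5/2 + y))"
    unfolding skew_moment_def h_def y_def f2[symmetric] by (simp add: f2 field_simps)
  have m2: "skew_moment a (2 * k + 2) (2 * k) = a * (real k + 1) * h"
    unfolding skew_moment_def h_def using f2(1) by (simp add: field_simps)
  have m3: "skew_moment a (2 * k + 3) (2 * k + 1) = a * (real k + 1) * (real k + 3/2) * h"
    unfolding skew_moment_def h_def using f2(2) by (simp add: field_simps power_add)
  have m4: "skew_moment a (2 * k + 2) (2 * k + 3) = (real k + 1) * (real k + 3/2) * h * (real k + 3 + y)"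
    unfolding skew_moment_def h_def y_def using f2(2) by (simp add: field_simps power_add)
  have orth: "skew_form a (q i) (q j) = 0" if "i < 2 * k + 2" "j < 2 * k + 2" "i div 2 \<noteq> j div 2" for i j
    using Suc.IH that by (simp add: q_def)
  have rho: "skew_form a (q (2 * k)) (q (2 * k + 1)) = of_real (skew_norm a k)"
    using Suc.IH by (simp add: q_def)
  have rho': "skew_form a (q (2 * k + 1)) (q (2 * k)) = - of_real (skew_norm a k)"
    using rho skew_form_antisym[of a "q (2 * k + 1)" "q (2 * k)"] by simp
  have me: "skew_form a (monom 1 (2 * k + 2)) (q j) = 0" if "j < 2 * k" for j
    using that by (subst skew_form_monom_left) (auto simp: q_def degree_skew_op coeff_eq_0)
  have me0: "skew_form a (monom 1 (2 * k + 2)) (q (2 * k)) = of_real (a * (real k + 1) * h)"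
    unfolding m2[symmetric] by (subst skew_form_monom_left) (auto simp: q_def degree_skew_op lead_coeff_skew_op coeff_eq_0)
  have me1: "skew_form a (monom 1 (2 * k + 2)) (q (2 * k + 1)) = - of_real ((real k + 1) * h * (real k + 5/2 + y))"
    unfolding of_real_minus[symmetric] m1[symmetric]
    by (subst skew_form_monom_left) (use lead_coeff_skew_op[of a "2 * k + 1"] coeff_skew_op_odd[of a k] in \<open>auto simp: q_def degree_skew_op\<close>)
  have e3: "2 * k + 3 = (2 * k + 1) + 2" by simp
  have mo: "skew_form a (monom 1 (2 * k + 3)) (q j) = 0" if "j < 2 * k + 1" for j
    unfolding e3 using that by (subst skew_form_monom_left) (auto simp: q_def degree_skew_op coeff_eq_0)
  have mo1: "skew_form a (monom 1 (2 * k + 3)) (q (2 * k + 1)) = of_real (a * (real k + 1) * (real k + 3/2) * h)"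
    unfolding m3[symmetric] unfolding e3
    by (subst skew_form_monom_left) (use lead_coeff_skew_op[of a "2 * k + 1"] in \<open>auto simp: q_def degree_skew_op coeff_eq_0\<close>)
  have e_low: "skew_form a (q (2 * k + 2)) (q j) = 0" if j: "j < 2 * k + 2" for j
  proof -
    consider "j < 2 * k" | "j = 2 * k" | "j = 2 * k + 1" using j by linarith
    thus ?thesis
    proof cases
      case 1
      hence "skew_form a (q (2 * k + 1)) (q j) = 0" "skew_form a (q (2 * k)) (q j) = 0" by (auto intro!: orth)
      thus ?thesis using me[OF 1] unfolding qe skew_form_linear by simp
    next
      case 2
      have "skew_form a (q (2 * k + 2)) (q j) = of_real (a * (real k + 1) * h - A * skew_norm a k)"
        unfolding 2 qe skew_form_linear me0 rho' skew_form_self by simp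
      also have "a * (real k + 1) * h - A * skew_norm a k = 0" using pos by (simp add: A_def R)
      finally show ?thesis by simp
    next
      case 3
      have "skew_form a (q (2 * k + 2)) (q j) = of_real (B * skew_norm a k - (real k + 1) * h * (real k + 5/2 + y))"
        unfolding 3 qe skew_form_linear me1 rho skew_form_self by simp
      also have "B * skew_norm a k - (real k + 1) * h * (real k + 5/2 + y) = 0" using pos by (simp add: B_def R)
      finally show ?thesis by simp
    qed
  qed
  have o_low: "skew_form a (q (2 * k + 3)) (q j) = 0" if j: "j < 2 * k + 2" for j
  proof -
    consider "j < 2 * k" | "j = 2 * k" | "j = 2 * k + 1" using j by linarith
    thus ?thesis
    proof cases
      case 1
      hence "skew_form a (q (2 * k)) (q j) = 0" by (auto intro!: orth)
      thus ?thesis using mo[of j] 1 unfolding qo skew_form_linear by simp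
    next
      case 2
      show ?thesis unfolding 2 qo skew_form_linear skew_form_self using mo[of "2 * k"] by simp
    next
      case 3
      have "skew_form a (q (2 * k + 3)) (q j) = of_real (a * (real k + 1) * (real k + 3/2) * h + D * skew_norm a k)"
        unfolding 3 qo skew_form_linear mo1 rho by simp
      also have "a * (real k + 1) * (real k + 3/2) * h + D * skew_norm a k = 0" using pos by (simp add: D_def R)
      finally show ?thesis by simp
    qed
  qed
  \<comment> \<open>The correction inside the odd polynomial drops out by \<open>e_low\<close>; what
    remains is \<open>pre_norm_rec\<close> divided by \<open>E1\<close>.\<close>
  have "skew_form a (q (2 * k + 2)) (q (2 * k + 3)) = skew_form a (q (2 * k + 2)) (monom 1 (2 * k + 3))"
    unfolding qo skew_form_linear using e_low[of "2 * k"] by simp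
  also have "\<dots> = of_real (skew_moment a (2 * k + 2) (2 * k + 3) - A * (a * (real k + 1) * (real k + 3/2) * h))"
    unfolding qe skew_form_linear skew_form_monom
      skew_form_antisym[of a "q (2 * k + 1)" "monom 1 (2 * k + 3)"] skew_form_antisym[of a "q (2 * k)" "monom 1 (2 * k + 3)"] mo1
    using mo[of "2 * k"] by simp
  also have "skew_moment a (2 * k + 2) (2 * k + 3) - A * (a * (real k + 1) * (real k + 3/2) * h)
      = (real k + 1) * (real k + 3/2) * h * E2 / E1"
    using pos unfolding m4 A_def E2_def pre_norm_rec E1_def[symmetric] E0_def[symmetric]
    by (simp add: field_simps y_def power2_eq_square)
  also have "\<dots> = skew_norm a (Suc k)"
  proof -
    have "2 * Suc k + 1 = 2 * k + 3" "2 * Suc k + 2 = 2 * k + 4" by simp_all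
    moreover have "fact (2 * k + 3) / 2 ^ (2 * k + 4) = (real k + 1) * (real k + 3/2) * h"
      unfolding f2(2) h_def power_add by (simp add: field_simps)
    ultimately show ?thesis
      unfolding skew_norm_def E1_def E2_def y_def by (simp only:) simp
  qed
  finally have new: "skew_form a (q (2 * k + 2)) (q (2 * k + 3)) = of_real (skew_norm a (Suc k))" .
  have all: "skew_form a (q i) (q j) = 0" if "i < 2 * k + 4" "j < 2 * k + 4" "i div 2 \<noteq> j div 2" for i j
  proof -
    have "i < 2 * k + 2 \<or> i = 2 * k + 2 \<or> i = 2 * k + 3" "j < 2 * k + 2 \<or> j = 2 * k + 2 \<or> j = 2 * k + 3"
      using that by linarith+
    moreover have "skew_form a (q j) (q i) = 0 \<Longrightarrow> ?thesis" using skew_form_antisym[of a "q i" "q j"] by simp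
    ultimately show ?thesis using that(3) orth[of i j] e_low[of i] e_low[of j] o_low[of i] o_low[of j] by auto
  qed
  have e: "2 * Suc k = 2 * k + 2" "2 * k + 2 + 1 = 2 * k + 3" "2 * k + 2 + 2 = 2 * k + 4" by simp_all
  show ?case using all new unfolding e q_def by blast
qed


section \<open>Values of the skew-orthogonal polynomials at \<open>a\<close>\<close>

definition over_sum :: "nat \<Rightarrow> real \<Rightarrow> real" where
  "over_sum N y = 2 / 3 * ((2 * real N + 1 - 2 * y) * exp_poly (2 * N) (2 * y)
     + (y - real N - 1) * half_term N y * exp_poly N y + y * half_term N y * (y ^ N / fact N))"

text \<open>The recursion that the values at \<open>a\<close> satisfy once the odd ones are
  eliminated. Everything reduces to the four quantities at level \<open>n\<close> named below, after
  which the claim is an identity of rational functions.\<close>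

lemma over_sum_rec:
  "(real n + 3/2) * over_sum (Suc (Suc n)) y = (real n + 5/2 + y) * over_sum (Suc n) y - y * over_sum n y
     + half_term (Suc n) y * ((2 * real n + 3 - 2 * y) * exp_poly (Suc n) y + 2 * y * (y ^ Suc n / fact (Suc n)))"
proof -
  define u where "u = y ^ n / fact n"
  define e where "e = exp_poly n y"
  define g where "g = half_term n y"
  define e2 where "e2 = exp_poly (2 * n) (2 * y)"
  have u: "y ^ Suc n / fact (Suc n) = u * y / (real n + 1)"
    "y ^ Suc (Suc n) / fact (Suc (Suc n)) = u * y / (real n + 1) * y / (real n + 2)"
    by (simp_all add: u_def field_simps)
  have e: "exp_poly (Suc n) y = e + u * y / (real n + 1)"
    "exp_poly (Suc (Suc n)) y = e + u * y / (real n + 1) + u * y / (real n + 1) * y / (real n + 2)"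
    by (simp_all add: exp_poly_Suc u_def e_def field_simps)
  have g: "half_term (Suc n) y = g * 2 * y / (2 * real n + 1)"
    "half_term (Suc (Suc n)) y = g * 2 * y / (2 * real n + 1) * 2 * y / (2 * real n + 3)"
    by (simp_all add: half_term_Suc g_def field_simps)
  have d1: "exp_poly (2 * Suc n) (2 * y) = e2 + g * u * (2 * y / (2 * real n + 1) * (1 + y / (real n + 1)))"
    unfolding exp_poly_double_Suc e2_def g_def u_def ..
  have d2: "exp_poly (2 * Suc (Suc n)) (2 * y) = e2 + g * u * (2 * y / (2 * real n + 1) * (1 + y / (real n + 1)))
      + (g * 2 * y / (2 * real n + 1)) * (u * y / (real n + 1)) * (2 * y / (2 * real n + 3) * (1 + y / (real n + 2)))"
    unfolding exp_poly_double_Suc[of "Suc n"] d1 g u by (simp add: algebra_simps)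
  have pos: "real n + 1 > 0" "real n + 2 > 0" "2 * real n + 1 > 0" "2 * real n + 3 > 0" by simp_all
  show ?thesis
    unfolding over_sum_def d1 d2 u e g u_def[symmetric] e_def[symmetric] g_def[symmetric] e2_def[symmetric]
    using pos by (simp add: divide_simps) (simp add: algebra_simps)
qed

text \<open>Prepares the inhomogeneous term in \<open>pre_norm_skew_op_value\<close>: the leading
  monomials of an even polynomial and of the odd one before it add up to the weighted sum that also
  occurs in \<open>kernel_slope_Suc\<close>.\<close>

lemma pre_norm_add:
  "pre_norm (Suc n) y + (real n + 1) * pre_norm n y
     = fact (Suc n) * ((2 * real n + 3 - 2 * y) * exp_poly (Suc n) y + 2 * y * (y ^ Suc n / fact (Suc n)))"
  unfolding pre_norm_def exp_poly_Suc by (simp add: divide_simps) (simp add: algebra_simps)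

text \<open>The coefficients of \<open>skew_op\<close> are real, so taking the real part loses
  nothing.\<close>

definition skew_op_value :: "real \<Rightarrow> nat \<Rightarrow> real" where
  "skew_op_value a m = Re (poly (skew_op a m) (of_real a))"

lemma Re_of_real_power: "Re (complex_of_real a ^ n) = a ^ n"
  by (simp flip: of_real_power)

lemma skew_op_value_even:
  "skew_op_value a (2 * k + 2) = a ^ (2 * k + 2)
     + a * (real k + 1) * (pre_norm k (a\<^sup>2) / pre_norm (Suc k) (a\<^sup>2)) * skew_op_value a (2 * k + 1)
     + (real k + 1) * (real k + 5/2 + a\<^sup>2) * (pre_norm k (a\<^sup>2) / pre_norm (Suc k) (a\<^sup>2)) * skew_op_value a (2 * k)"
  unfolding skew_op_value_def skew_op_even poly_add poly_smult poly_monom plus_complex.sel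
    Re_complex_of_real Re_of_real_power
  by (simp only: times_complex.sel Re_complex_of_real Im_complex_of_real Re_of_real_power) simp

lemma skew_op_value_odd:
  "skew_op_value a (2 * k + 3) = a ^ (2 * k + 3)
     - a * (real k + 1) * (real k + 3/2) * (pre_norm k (a\<^sup>2) / pre_norm (Suc k) (a\<^sup>2)) * skew_op_value a (2 * k)"
  unfolding skew_op_value_def skew_op_odd poly_add poly_smult poly_monom plus_complex.sel
  by (simp only: times_complex.sel Re_complex_of_real Im_complex_of_real Re_of_real_power) simp

text \<open>Multiplying by \<open>pre_norm\<close> clears the denominators of the Gram-Schmidt
  coefficients. Substituting the odd values into the even ones leaves a recursion of order two, so
  the induction carries two consecutive values.\<close>

lemma pre_norm_skew_op_value:
  "pre_norm n (a\<^sup>2) * skew_op_value a (2 * n) = fact n * pochhammer (1/2) (Suc n) * over_sum (Suc n) (a\<^sup>2)"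
proof -
  define y where "y = a\<^sup>2"
  define x where "x n = pre_norm n y * skew_op_value a (2 * n)" for n
  have nz: "pre_norm n y \<noteq> 0" for n using pre_norm_pos[of y n] by (simp add: y_def)
  have ya: "a ^ (2 * n) = y ^ n" for n by (simp add: y_def power_mult)
  have even: "x (Suc n) = y ^ Suc n * pre_norm (Suc n) y
      + a * (real n + 1) * (pre_norm n y * skew_op_value a (2 * n + 1))
      + (real n + 1) * (real n + 5/2 + y) * x n" for n
  proof -
    have "2 * Suc n = 2 * n + 2" by simp
    thus ?thesis using nz[of "Suc n"] ya[of "Suc n"]
      unfolding x_def by (simp only: skew_op_value_even) (simp add: y_def[symmetric] field_simps)
  qed
  have odd: "pre_norm (Suc n) y * skew_op_value a (2 * Suc n + 1) = a * y ^ Suc n * pre_norm (Suc n) y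
      - a * (real n + 1) * (real n + 3/2) * x n" for n
  proof -
    have "2 * Suc n + 1 = 2 * n + 3" "a ^ (2 * n + 3) = a * a ^ (2 * Suc n)" by (simp_all add: power_add numeral_eq_Suc)
    thus ?thesis using nz[of "Suc n"]
      unfolding x_def by (simp only: skew_op_value_odd ya) (simp add: y_def[symmetric] field_simps)
  qed
  have v0: "skew_op_value a 0 = 1" "skew_op_value a 1 = a" by (simp_all add: skew_op_value_def poly_monom)
  have P: "pochhammer (1/2) (Suc n) = pochhammer (1/2) n * (real n + 1/2)" for n
    by (simp add: pochhammer_Suc add.commute)
  have "x n = fact n * pochhammer (1/2) (Suc n) * over_sum (Suc n) y
    \<and> x (Suc n) = fact (Suc n) * pochhammer (1/2) (Suc (Suc n)) * over_sum (Suc (Suc n)) y"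
  proof (induction n)
    case 0
    \<comment> \<open>With this value at \<open>N = 0\<close> the recursion
      \<open>over_sum_rec\<close> already reaches \<open>N = 2\<close>.\<close>
    have s0: "over_sum 0 y = 0" by (simp add: over_sum_def)
    have s1: "over_sum (Suc 0) y = 2"
      by (simp add: over_sum_def exp_poly_def half_term_def atMost_Suc field_simps power2_eq_square numeral_2_eq_2)
    have "x 1 = y * (2 + y) + a * a + (5/2 + y)"
      using even[of 0] v0 unfolding x_def by (simp add: pre_norm_1)
    moreover have "over_sum (Suc (Suc 0)) y = (5/2 + y) * 2 / (3/2) + 2 * y * ((3 - 2 * y) * (1 + y) + 2 * y * y) / (3/2)"
      using over_sum_rec[of 0 y] unfolding s0 s1 by (simp add: half_term_Suc exp_poly_Suc field_simps)
    moreover have "x 0 = 1" using v0 by (simp add: x_def)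
    ultimately show ?case
      using s1 by (simp add: pochhammer_Suc y_def power2_eq_square field_simps)
  next
    case (Suc n)
    let ?P = "pochhammer (1/2) (Suc n) :: real"
    have Ppos: "?P > 0" by (rule pochhammer_pos) simp
    have h: "y ^ Suc (Suc n) = half_term (Suc (Suc n)) y * (?P * (real n + 3/2))"
    proof -
      have "pochhammer (1/2) (Suc (Suc n)) = ?P * (real n + 3/2)" by (simp only: P[of "Suc n"]) simp
      thus ?thesis using Ppos unfolding half_term_def by simp
    qed
    have "x (Suc (Suc n)) = y ^ Suc (Suc n) * (pre_norm (Suc (Suc n)) y + (real (Suc n) + 1) * pre_norm (Suc n) y)
        - (real n + 2) * y * (real n + 1) * (real n + 3/2) * x n + (real n + 2) * (real n + 7/2 + y) * x (Suc n)"
      unfolding even[of "Suc n"] odd by (simp add: y_def power2_eq_square algebra_simps)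
    also have "\<dots> = fact (Suc (Suc n)) * (?P * (real n + 3/2)) *
        ((real (Suc n) + 5/2 + y) * over_sum (Suc (Suc n)) y - y * over_sum (Suc n) y
         + half_term (Suc (Suc n)) y * ((2 * real (Suc n) + 3 - 2 * y) * exp_poly (Suc (Suc n)) y
            + 2 * y * (y ^ Suc (Suc n) / fact (Suc (Suc n)))))"
    proof -
      have xs: "x n = fact n * ?P * over_sum (Suc n) y"
        "x (Suc n) = (real n + 1) * fact n * (?P * (real n + 3/2)) * over_sum (Suc (Suc n)) y"
        using Suc.IH P[of "Suc n"] by (simp_all add: add.commute)
      have f: "fact (Suc (Suc n)) = (real n + 2) * ((real n + 1) * fact n)" by (simp add: algebra_simps)
      have alg: "g * (P * t) * ((r2 * (r1 * F)) * X) - r2 * y * r1 * t * (F * P * S1) + r2 * w * (r1 * F * (P * t) * S2)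
          = (r2 * (r1 * F)) * (P * t) * (w' * S2 - y * S1 + g * X)" if "w = w'" for g P t r1 r2 F X S1 S2 w w' :: real
        using that by (simp add: algebra_simps)
      define X where "X = (2 * real (Suc n) + 3 - 2 * y) * exp_poly (Suc (Suc n)) y
            + 2 * y * (y ^ Suc (Suc n) / fact (Suc (Suc n)))"
      show ?thesis
        unfolding pre_norm_add X_def[symmetric] xs unfolding h f
        by (rule alg) simp_all
    qed
    also have "\<dots> = fact (Suc (Suc n)) * (?P * (real n + 3/2)) * ((real (Suc n) + 3/2) * over_sum (Suc (Suc (Suc n))) y)"
      using over_sum_rec[of "Suc n" y] by simp
    also have "\<dots> = fact (Suc (Suc n)) * pochhammer (1/2) (Suc (Suc (Suc n))) * over_sum (Suc (Suc (Suc n))) y"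
    proof -
      have "real (Suc (Suc n)) + 1/2 = real (Suc n) + 3/2" "real (Suc n) + 1/2 = real n + 3/2" by simp_all
      thus ?thesis by (simp only: P[of "Suc (Suc n)"] P[of "Suc n"] mult_ac)
    qed
    finally show ?case using Suc.IH by blast
  qed
  thus ?thesis by (simp add: x_def y_def)
qed

section \<open>The partition function\<close>

lemma prod_lessThan_double: "(\<Prod>i<2 * n. f i) = (\<Prod>j<n. f (2 * j) * f (2 * j + 1))" for n :: nat
  by (induction n) (simp_all add: mult.assoc)

definition conj_pairs :: "(nat \<Rightarrow> complex) \<Rightarrow> nat \<Rightarrow> complex" where
  "conj_pairs w i = (if even i then w (i div 2) else cnj (w (i div 2)))"

lemma conj_pairs_simps [simp]: "conj_pairs w (2 * j) = w j" "conj_pairs w (Suc (2 * j)) = cnj (w j)"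
  by (simp_all add: conj_pairs_def)

lemma cmod_diff_square: "complex_of_real ((cmod (z - w))\<^sup>2) = (w - z) * (cnj w - cnj z)"
  by (simp only: complex_norm_square) (simp add: algebra_simps)

text \<open>For \<open>j < k\<close> the two conjugate pairs give four differences, which group into
  two squared moduli; within a pair the single difference \<open>cnj (w j) - w j\<close> stays
  unmatched.\<close>

lemma vandermonde_conj_pairs:
  "(\<Prod>i<2 * n. \<Prod>j<i. conj_pairs w i - conj_pairs w j)
    = of_real (\<Prod>j<n. \<Prod>k\<in>{j<..<n}. (cmod (w j - w k))\<^sup>2 * (cmod (w j - cnj (w k)))\<^sup>2) * (\<Prod>j<n. cnj (w j) - w j)"
proof (induction n)
  case (Suc n)
  let ?F = "\<lambda>j k. (cmod (w j - w k))\<^sup>2 * (cmod (w j - cnj (w k)))\<^sup>2"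
  have F: "complex_of_real (?F j n) = (w n - w j) * (w n - cnj (w j)) * ((cnj (w n) - w j) * (cnj (w n) - cnj (w j)))" for j
    by (simp only: of_real_mult cmod_diff_square) simp
  have "(\<Prod>j<Suc n. \<Prod>k\<in>{j<..<Suc n}. ?F j k) = (\<Prod>j<n. (\<Prod>k\<in>{j<..<n}. ?F j k) * ?F j n)"
  proof -
    have "{j<..<Suc n} = insert n {j<..<n}" if "j < n" for j using that by auto
    moreover have "{n<..<Suc n} = {}" by auto
    ultimately show ?thesis by (auto simp: mult.commute intro!: prod.cong)
  qed
  hence R: "(\<Prod>j<Suc n. \<Prod>k\<in>{j<..<Suc n}. ?F j k) = (\<Prod>j<n. \<Prod>k\<in>{j<..<n}. ?F j k) * (\<Prod>j<n. ?F j n)"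
    by (simp only: prod.distrib)
  have "2 * Suc n = Suc (Suc (2 * n))" by simp
  hence "(\<Prod>i<2 * Suc n. \<Prod>j<i. conj_pairs w i - conj_pairs w j)
     = (\<Prod>i<2 * n. \<Prod>j<i. conj_pairs w i - conj_pairs w j)
       * (\<Prod>j<2 * n. w n - conj_pairs w j) * ((\<Prod>j<2 * n. cnj (w n) - conj_pairs w j) * (cnj (w n) - w n))"
    by (simp only: prod.lessThan_Suc conj_pairs_simps mult.assoc)
  also have "\<dots> = (\<Prod>i<2 * n. \<Prod>j<i. conj_pairs w i - conj_pairs w j) * of_real (\<Prod>j<n. ?F j n) * (cnj (w n) - w n)"
    unfolding prod_lessThan_double of_real_prod F by (simp add: prod.distrib)
  finally show ?case unfolding Suc.IH R by (simp only: of_real_mult prod.lessThan_Suc mult_ac)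
qed simp

text \<open>The point \<open>a\<close> comes last, at index \<open>2n\<close>. Its differences to
  \<open>w j\<close> and \<open>cnj (w j)\<close> supply the factor \<open>|w j - a|\<^sup>2\<close>
  of \<open>omega_over\<close>, and \<open>pre_weight\<close> supplies the second factor of
  \<open>|w j - cnj (w j)|\<^sup>2\<close>.\<close>

lemma over_integrand_eq:
  "of_real ((1 / pi) ^ n * ((\<Prod>j<n. \<Prod>k\<in>{j<..<n}. (cmod (w j - w k))\<^sup>2 * (cmod (w j - cnj (w k)))\<^sup>2) *
        (\<Prod>j<n. (cmod (w j - cnj (w j)))\<^sup>2 * omega_over a (w j))))
    = (\<Sum>p | p permutes {..<2 * n + 1}. of_int (sign p) * poly (skew_op a (p (2 * n))) (of_real a) *
        (\<Prod>j<n. poly (skew_op a (p (2 * j))) (w j) * poly (skew_op a (p (2 * j + 1))) (cnj (w j)) * pre_weight a (w j)))"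
proof -
  define x where "x i = (if i < 2 * n then conj_pairs w i else of_real a)" for i
  let ?D = "\<Prod>j<n. \<Prod>k\<in>{j<..<n}. (cmod (w j - w k))\<^sup>2 * (cmod (w j - cnj (w k)))\<^sup>2"
  have "(\<Prod>i<2 * n + 1. \<Prod>j<i. x i - x j)
      = (\<Prod>i<2 * n. \<Prod>j<i. conj_pairs w i - conj_pairs w j) * (\<Prod>j<2 * n. of_real a - conj_pairs w j)"
    by (simp add: x_def)
  also have "\<dots> = of_real ?D * (\<Prod>j<n. (cnj (w j) - w j) * ((of_real a - w j) * (of_real a - cnj (w j))))"
    unfolding vandermonde_conj_pairs prod_lessThan_double by (simp add: prod.distrib)
  finally have "(\<Prod>i<2 * n + 1. \<Prod>j<i. x i - x j) * (\<Prod>j<n. pre_weight a (w j))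
      = of_real ?D * (\<Prod>j<n. (cnj (w j) - w j) * ((of_real a - w j) * (of_real a - cnj (w j))) * pre_weight a (w j))"
    by (simp add: prod.distrib)
  also have "(\<Prod>j<n. (cnj (w j) - w j) * ((of_real a - w j) * (of_real a - cnj (w j))) * pre_weight a (w j))
      = (\<Prod>j<n. of_real (1 / pi * ((cmod (w j - cnj (w j)))\<^sup>2 * omega_over a (w j))))"
  proof (rule prod.cong[OF refl])
    fix j
    have 1: "complex_of_real ((cmod (w j - cnj (w j)))\<^sup>2) = (cnj (w j) - w j) * (w j - cnj (w j))"
      by (simp only: cmod_diff_square) simp
    have 2: "complex_of_real ((cmod (w j - of_real a))\<^sup>2) = (of_real a - w j) * (of_real a - cnj (w j))"
      by (simp only: cmod_diff_square) simp
    have "of_real (1 / pi * ((cmod (w j - cnj (w j)))\<^sup>2 * omega_over a (w j)))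
        = complex_of_real ((cmod (w j - cnj (w j)))\<^sup>2) * complex_of_real ((cmod (w j - of_real a))\<^sup>2)
          * of_real ((1 + (cmod (w j - of_real a))\<^sup>2) * exp (-2 * (cmod (w j))\<^sup>2) / pi)"
      unfolding omega_over_def of_real_mult[symmetric] by (intro arg_cong[of _ _ complex_of_real]) simp
    thus "(cnj (w j) - w j) * ((of_real a - w j) * (of_real a - cnj (w j))) * pre_weight a (w j)
        = of_real (1 / pi * ((cmod (w j - cnj (w j)))\<^sup>2 * omega_over a (w j)))"
      unfolding 1 2 pre_weight_def by (simp only: mult_ac)
  qed
  also have "of_real ?D * \<dots> = of_real ((1 / pi) ^ n * (?D * (\<Prod>j<n. (cmod (w j - cnj (w j)))\<^sup>2 * omega_over a (w j))))"
    unfolding of_real_prod[symmetric] of_real_mult[symmetric]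
    by (intro arg_cong[of _ _ complex_of_real]) (simp only: prod.distrib prod_constant card_lessThan mult_ac)
  finally have "of_real ((1 / pi) ^ n * (?D * (\<Prod>j<n. (cmod (w j - cnj (w j)))\<^sup>2 * omega_over a (w j))))
      = (\<Prod>i<2 * n + 1. \<Prod>j<i. x i - x j) * (\<Prod>j<n. pre_weight a (w j))" by simp
  also have "(\<Prod>i<2 * n + 1. \<Prod>j<i. x i - x j) = (\<Sum>p | p permutes {..<2 * n + 1}. of_int (sign p)
      * (\<Prod>i<2 * n + 1. poly (skew_op a (p i)) (x i)))"
    by (rule prod_monic_family_permutations) (simp add: degree_skew_op lead_coeff_skew_op)
  also have "\<dots> * (\<Prod>j<n. pre_weight a (w j)) = (\<Sum>p | p permutes {..<2 * n + 1}.
        of_int (sign p) * poly (skew_op a (p (2 * n))) (of_real a) *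
        (\<Prod>j<n. poly (skew_op a (p (2 * j))) (w j) * poly (skew_op a (p (2 * j + 1))) (cnj (w j)) * pre_weight a (w j)))"
    unfolding sum_distrib_right
  proof (rule sum.cong[OF refl])
    fix p :: "nat \<Rightarrow> nat"
    have "(\<Prod>i<2 * n. poly (skew_op a (p i)) (x i)) = (\<Prod>i<2 * n. poly (skew_op a (p i)) (conj_pairs w i))"
      by (rule prod.cong) (auto simp: x_def)
    hence "(\<Prod>i<2 * n + 1. poly (skew_op a (p i)) (x i))
        = (\<Prod>j<n. poly (skew_op a (p (2 * j))) (w j) * poly (skew_op a (p (2 * j + 1))) (cnj (w j)))
          * poly (skew_op a (p (2 * n))) (of_real a)"
      by (simp add: prod_lessThan_double) (simp add: x_def)
    thus "of_int (sign p) * (\<Prod>i<2 * n + 1. poly (skew_op a (p i)) (x i)) * (\<Prod>j<n. pre_weight a (w j))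
      = of_int (sign p) * poly (skew_op a (p (2 * n))) (of_real a) *
        (\<Prod>j<n. poly (skew_op a (p (2 * j))) (w j) * poly (skew_op a (p (2 * j + 1))) (cnj (w j)) * pre_weight a (w j))"
      by (simp only: prod.distrib mult_ac)
  qed
  finally show ?thesis .
qed

text \<open>De Bruijn's integration: after the Leibniz expansion the variables \<open>w j\<close>
  sit in separate factors, each of which integrates to a skew product.\<close>

lemma Zover_permutation_sum:
  "complex_of_real (Zover n a) = (\<Sum>p | p permutes {..<2 * n + 1}. of_int (sign p) * poly (skew_op a (p (2 * n))) (of_real a) *
      (\<Prod>j<n. skew_form a (skew_op a (p (2 * j))) (skew_op a (p (2 * j + 1)))))"
proof -
  interpret product_sigma_finite "\<lambda>_::nat. lborel :: complex measure" ..
  let ?M = "PiM {..<n} (\<lambda>_. lborel :: complex measure)"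
  define f where "f p j z = poly (skew_op a (p (2 * j))) z * poly (skew_op a (p (2 * j + 1))) (cnj z) * pre_weight a z"
    for p :: "nat \<Rightarrow> nat" and j :: nat and z
  have f: "integrable lborel (f p j)" for p j
    unfolding f_def by (rule integrable_skew)
  have "complex_of_real (Zover n a) = (LINT w|?M. of_real ((1 / pi) ^ n *
      ((\<Prod>j<n. \<Prod>k\<in>{j<..<n}. (cmod (w j - w k))\<^sup>2 * (cmod (w j - cnj (w k)))\<^sup>2) *
        (\<Prod>j<n. (cmod (w j - cnj (w j)))\<^sup>2 * omega_over a (w j)))))"
    unfolding Zover_def integral_complex_of_real by simp
  also have "\<dots> = (LINT w|?M. (\<Sum>p | p permutes {..<2 * n + 1}.
      of_int (sign p) * poly (skew_op a (p (2 * n))) (of_real a) * (\<Prod>j<n. f p j (w j))))"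
    unfolding over_integrand_eq f_def ..
  also have "\<dots> = (\<Sum>p | p permutes {..<2 * n + 1}.
      of_int (sign p) * poly (skew_op a (p (2 * n))) (of_real a) * (\<Prod>j<n. LINT z|lborel. f p j z))"
    using f by (subst Bochner_Integration.integral_sum)
      (auto intro!: integrable_mult_right product_integrable_prod simp: product_integral_prod)
  finally show ?thesis unfolding f_def skew_form_def .
qed

text \<open>The index \<open>2n\<close> must fall on the point \<open>a\<close>: anywhere else it is
  paired with a smaller index, necessarily from a lower block, and that factor vanishes.\<close>

lemma Zover_eq_skew_norms:
  "complex_of_real (Zover n a)
    = fact n * (\<Prod>k<n. 2 * of_real (skew_norm a k)) * poly (skew_op a (2 * n)) (of_real a)"
proof -
  define m where "m i k = skew_form a (skew_op a i) (skew_op a k)" for i k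
  have anti: "m i k = - m k i" for i k unfolding m_def by (rule skew_form_antisym)
  \<comment> \<open>The bound goes past the \<open>2n + 1\<close> indices in use to complete block
    \<open>n\<close>, which contains the index \<open>2n\<close>.\<close>
  have orth: "m i k = 0" if "i < 2 * n + 2" "k < 2 * n + 2" "i div 2 \<noteq> k div 2" for i k
    using skew_op_orthogonal[of n a] that unfolding m_def by blast
  have norm: "m (2 * k) (2 * k + 1) = of_real (skew_norm a k)" for k
    using skew_op_orthogonal[of k a] unfolding m_def by blast
  let ?G = "\<lambda>p. of_int (sign p) * poly (skew_op a (p (2 * n))) (of_real a) * (\<Prod>j<n. m (p (2 * j)) (p (2 * j + 1)))"
  have "complex_of_real (Zover n a) = (\<Sum>p | p permutes {..<2 * n + 1}. ?G p)"
    unfolding Zover_permutation_sum m_def ..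
  also have "\<dots> = (\<Sum>p | p permutes {..<2 * n}. ?G p)"
  proof (rule sum.mono_neutral_right)
    show "finite {p. p permutes {..<2 * n + 1}}" by (rule finite_permutations) simp
    show "{p. p permutes {..<2 * n}} \<subseteq> {p. p permutes {..<2 * n + 1}}"
      by (auto elim: permutes_subset)
    show "\<forall>p\<in>{p. p permutes {..<2 * n + 1}} - {p. p permutes {..<2 * n}}. ?G p = 0"
    proof
      fix p assume p: "p \<in> {p. p permutes {..<2 * n + 1}} - {p. p permutes {..<2 * n}}"
      hence pP: "p permutes {..<2 * n + 1}" by blast
      have "p (2 * n) \<noteq> 2 * n"
      proof
        assume pn: "p (2 * n) = 2 * n"
        have "p permutes {..<2 * n}"
          by (rule permutes_superset[OF pP]) (use pn in \<open>auto simp: less_Suc_eq\<close>)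
        thus False using p by blast
      qed
      moreover have "2 * n \<in> p ` {..<2 * n + 1}" using pP by (simp add: permutes_image)
      then obtain i where i: "i < 2 * n + 1" "p i = 2 * n" by (metis imageE lessThan_iff)
      ultimately have "i \<noteq> 2 * n" by metis
      hence i2: "i < 2 * n" using i by linarith
      define j where "j = i div 2"
      have j: "j < n" using i2 by (simp add: j_def)
      have lt: "p k < 2 * n" if "k < 2 * n" "k \<noteq> i" for k
      proof -
        have "p k \<noteq> p i" using that(2) permutes_inj[OF pP] by (simp add: inj_eq)
        moreover have "p k < 2 * n + 1" using permutes_in_image[OF pP, of k] that by simp
        ultimately show ?thesis using i(2) by linarith
      qed
      have ij: "i = 2 * j \<or> i = 2 * j + 1" unfolding j_def by presburger
      have "m (p (2 * j)) (p (2 * j + 1)) = 0"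
      proof (rule orth)
        have "p (2 * j) = 2 * n \<and> p (2 * j + 1) < 2 * n \<or> p (2 * j + 1) = 2 * n \<and> p (2 * j) < 2 * n"
          using ij i(2) lt[of "2 * j"] lt[of "2 * j + 1"] j by auto
        thus "p (2 * j) < 2 * n + 2" "p (2 * j + 1) < 2 * n + 2" "p (2 * j) div 2 \<noteq> p (2 * j + 1) div 2"
          by auto
      qed
      hence "(\<Prod>j<n. m (p (2 * j)) (p (2 * j + 1))) = 0" using j by (intro prod_zero) auto
      thus "?G p = 0" by simp
    qed
  qed
  also have "\<dots> = (\<Sum>p | p permutes {..<2 * n}. of_int (sign p) * (\<Prod>j<n. m (p (2 * j)) (p (2 * j + 1))))
      * poly (skew_op a (2 * n)) (of_real a)"
    unfolding sum_distrib_right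
  proof (rule sum.cong[OF refl])
    fix p assume "p \<in> {p. p permutes {..<2 * n}}"
    hence "p (2 * n) = 2 * n" by (simp add: permutes_not_in)
    thus "?G p = of_int (sign p) * (\<Prod>j<n. m (p (2 * j)) (p (2 * j + 1))) * poly (skew_op a (2 * n)) (of_real a)"
      by (simp only: mult_ac)
  qed
  also have "(\<Sum>p | p permutes {..<2 * n}. of_int (sign p) * (\<Prod>j<n. m (p (2 * j)) (p (2 * j + 1))))
      = fact n * (\<Prod>k<n. 2 * m (2 * k) (2 * k + 1))"
    by (rule sum_pairing_permutations) (rule anti, rule orth, simp_all)
  finally show ?thesis unfolding norm .
qed

lemma Zover_closed_form:
  "Zover n a = fact n * (\<Prod>k<n. fact (2 * k + 1) / 2 ^ (2 * k + 1)) * (fact n * pochhammer (1/2) (Suc n) * over_sum (Suc n) (a\<^sup>2))"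
proof -
  have "complex_of_real (Zover n a) = of_real (fact n * (\<Prod>k<n. 2 * skew_norm a k)) * poly (skew_op a (2 * n)) (of_real a)"
    unfolding Zover_eq_skew_norms by simp
  hence "Re (complex_of_real (Zover n a)) = Re (of_real (fact n * (\<Prod>k<n. 2 * skew_norm a k)) * poly (skew_op a (2 * n)) (of_real a))"
    by (rule arg_cong)
  hence Z: "Zover n a = fact n * (\<Prod>k<n. 2 * skew_norm a k) * skew_op_value a (2 * n)"
    by (simp only: skew_op_value_def times_complex.sel Re_complex_of_real Im_complex_of_real mult_zero_left diff_zero)
  \<comment> \<open>The quotients of consecutive \<open>pre_norm\<close> telescope, starting from
    \<open>pre_norm 0 = 1\<close>.\<close>
  have "(\<Prod>k<n. 2 * skew_norm a k) = (\<Prod>k<n. fact (2 * k + 1) / 2 ^ (2 * k + 1)) * pre_norm n (a\<^sup>2)"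
  proof (induction n)
    case (Suc n)
    have "pre_norm n (a\<^sup>2) > 0" by (rule pre_norm_pos) simp
    moreover have "2 * skew_norm a n = fact (2 * n + 1) / 2 ^ (2 * n + 1) * (pre_norm (Suc n) (a\<^sup>2) / pre_norm n (a\<^sup>2))"
      by (simp add: skew_norm_def mult_ac)
    ultimately show ?case by (simp only: prod.lessThan_Suc Suc.IH) simp
  qed simp
  thus ?thesis unfolding Z using pre_norm_skew_op_value[of n a] by (simp add: mult.assoc)
qed

lemma Dhat_closed_form:
  assumes "N > 0"
  shows "Dhat N a = over_sum N (a\<^sup>2) / kernel_slope N (a\<^sup>2)"
proof -
  obtain n where N: "N = Suc n" using assms gr0_implies_Suc by blast
  define Q where "Q = (\<Prod>k<n. fact (2 * k + 1) / 2 ^ (2 * k + 1) :: real)"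
  define P where "P = (pochhammer (1/2) (Suc n) :: real)"
  have Q: "Q > 0" unfolding Q_def by (intro prod_pos) simp
  have P: "P > 0" unfolding P_def by (rule pochhammer_pos) simp
  \<comment> \<open>The last factor of \<open>Zg N\<close>, rewritten by the duplication formula so
    that it cancels the constants of \<open>Zover_closed_form\<close>.\<close>
  have f: "fact (2 * n + 1) / 2 ^ (2 * n + 1) = fact n * P"
  proof -
    have "2 ^ (2 * Suc n) * (P * fact (Suc n)) = fact (2 * Suc n)"
      by (simp only: fact_double P_def mult.assoc)
    also have "fact (2 * Suc n) = (2 * real n + 2) * fact (2 * n + 1)" by (simp add: algebra_simps)
    finally have "2 * 2 ^ (2 * n + 1) * P * ((real n + 1) * fact n) = 2 * (real n + 1) * fact (2 * n + 1)"
      by (simp add: algebra_simps)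
    hence "(2 * (real n + 1)) * (2 ^ (2 * n + 1) * P * fact n) = (2 * (real n + 1)) * fact (2 * n + 1)"
      by (simp only: mult_ac)
    moreover have "2 * (real n + 1) \<noteq> 0" by simp
    ultimately have "2 ^ (2 * n + 1) * P * fact n = fact (2 * n + 1)" by (metis mult_left_cancel)
    thus ?thesis by (simp add: field_simps)
  qed
  have "fact (Suc n) = real N * fact n" unfolding N by simp
  hence "Zg N = real N * fact n * (Q * (fact n * P))"
    unfolding Zg_def unfolding N prod.lessThan_Suc Q_def[symmetric] f by (simp only:)
  moreover have "Zover (N - 1) a = fact n * Q * (fact n * P * over_sum N (a\<^sup>2))"
    unfolding Zover_closed_form N Q_def P_def by simp
  ultimately have "real N * Zover (N - 1) a / Zg N = over_sum N (a\<^sup>2)"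
    using P Q assms by (simp add: field_simps)
  thus ?thesis unfolding Dhat_def deriv_kappa_hat by simp
qed

section \<open>Gaussian limits of Poisson distributions\<close>

definition poisson_cdf :: "nat \<Rightarrow> real \<Rightarrow> real" where
  "poisson_cdf n y = exp (- y) * exp_poly n y"

text \<open>Profile of \<open>y^n * exp (- y)\<close> at \<open>y = n + s * sqrt n\<close>, divided
  by its value at the maximum \<open>s = 0\<close>.\<close>

definition scaled_density :: "nat \<Rightarrow> real \<Rightarrow> real" where
  "scaled_density n s = (1 + s / sqrt n) ^ n * exp (- (s * sqrt n))"

text \<open>The probability that a Poisson variable of mean \<open>n\<close> equals
  \<open>n\<close>, times its standard deviation.\<close>

definition stirling_ratio :: "nat \<Rightarrow> real" where
  "stirling_ratio n = real n ^ n * exp (- real n) * sqrt n / fact n"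

lemma exp_poly_has_derivative:
  "(exp_poly n has_real_derivative exp_poly n y - y ^ n / fact n) (at y)"
proof (induction n)
  case 0
  have "exp_poly 0 = (\<lambda>_. 1)" by (simp add: fun_eq_iff)
  thus ?case by simp
next
  case (Suc n)
  have e: "exp_poly (Suc n) = (\<lambda>y. exp_poly n y + y ^ Suc n / fact (Suc n))"
    by (simp add: exp_poly_def fun_eq_iff)
  have "((\<lambda>y. y ^ Suc n / fact (Suc n)) has_real_derivative real (Suc n) * y ^ n / fact (Suc n)) (at y)"
    by (intro DERIV_cdivide DERIV_pow[THEN DERIV_cong]) simp
  moreover have "real (Suc n) * y ^ n / fact (Suc n) = y ^ n / fact n" by simp
  ultimately have "((\<lambda>y. exp_poly n y + y ^ Suc n / fact (Suc n)) has_real_derivative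
      (exp_poly n y - y ^ n / fact n) + y ^ n / fact n) (at y)"
    by (intro DERIV_add Suc.IH) simp
  thus ?case unfolding e by simp
qed

text \<open>The derivative telescopes: as a function of its mean, the Poisson distribution function
  is the tail of a Gamma distribution of shape \<open>n + 1\<close>.\<close>

lemma poisson_cdf_has_derivative:
  "(poisson_cdf n has_real_derivative - (exp (- y) * y ^ n / fact n)) (at y)"
  unfolding poisson_cdf_def[abs_def]
  by (rule derivative_eq_intros exp_poly_has_derivative refl | simp add: algebra_simps)+

lemma poisson_cdf_tendsto_0: "(poisson_cdf n \<longlongrightarrow> 0) at_top"
proof -
  have "poisson_cdf n = (\<lambda>y. \<Sum>j\<le>n. y ^ j / exp y / fact j)"
    by (auto simp: poisson_cdf_def exp_poly_def fun_eq_iff sum_distrib_left exp_minus field_simps)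
  moreover have "((\<lambda>y::real. \<Sum>j\<le>n. y ^ j / exp y / fact j) \<longlongrightarrow> (\<Sum>j\<le>n. 0 / fact j)) at_top"
    by (intro tendsto_sum tendsto_divide tendsto_power_div_exp_0 tendsto_const) simp
  ultimately show ?thesis by simp
qed

lemma poisson_weight_scaled:
  assumes "n > 0"
  shows "exp (- (real n + s * sqrt n)) * (real n + s * sqrt n) ^ n = real n ^ n * exp (- real n) * scaled_density n s"
proof -
  have "real n + s * sqrt n = real n * (1 + s / sqrt n)"
    using assms by (simp add: field_simps)
  hence "(real n + s * sqrt n) ^ n = real n ^ n * (1 + s / sqrt n) ^ n" by (simp only: power_mult_distrib)
  moreover have "exp (- (real n + s * sqrt n)) = exp (- real n) * exp (- (s * sqrt n))"
    by (simp flip: exp_add)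
  ultimately show ?thesis by (simp only: scaled_density_def mult_ac)
qed

lemma scaled_density_nonneg: "n > 0 \<Longrightarrow> s \<ge> - sqrt n \<Longrightarrow> scaled_density n s \<ge> 0"
  unfolding scaled_density_def by (intro mult_nonneg_nonneg zero_le_power) (simp_all add: field_simps)

lemma stirling_ratio_pos: "n > 0 \<Longrightarrow> stirling_ratio n > 0"
  by (simp add: stirling_ratio_def)

lemma scaled_density_borel [measurable]: "scaled_density n \<in> borel_measurable borel"
  unfolding scaled_density_def[abs_def] by measurable

text \<open>Fundamental theorem of calculus on a half line. The bound on \<open>x\<close> says that
  the mean is nonnegative, which makes the integrand nonnegative.\<close>

lemma poisson_cdf_integral:
  assumes n: "n > 0" and x: "x \<ge> - sqrt n"
  shows "poisson_cdf n (real n + x * sqrt n) = stirling_ratio n * (LINT s|lborel. indicator {x..} s * scaled_density n s)"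
proof -
  let ?F = "\<lambda>s. - poisson_cdf n (real n + s * sqrt n)"
  let ?f = "\<lambda>s. stirling_ratio n * scaled_density n s"
  have d: "(?F has_real_derivative ?f s) (at s)" for s
  proof -
    have "((\<lambda>s. poisson_cdf n (real n + s * sqrt n)) has_real_derivative
        - (exp (- (real n + s * sqrt n)) * (real n + s * sqrt n) ^ n / fact n) * sqrt n) (at s)"
      by (rule DERIV_chain2[OF poisson_cdf_has_derivative]) (auto intro!: derivative_eq_intros)
    from DERIV_minus[OF this] show ?thesis
      unfolding poisson_weight_scaled[OF n] by (simp add: stirling_ratio_def field_simps)
  qed
  have nn: "?f s \<ge> 0" if "x \<le> s" for s
    using that x n scaled_density_nonneg[of n s] stirling_ratio_pos[of n] by simp
  have "filterlim (\<lambda>s. real n + s * sqrt n) at_top at_top"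
    using n by real_asymp
  hence "(?F \<longlongrightarrow> - 0) at_top"
    by (intro tendsto_minus filterlim_compose[OF poisson_cdf_tendsto_0])
  hence "(\<integral>\<^sup>+s. ennreal (?f s) * indicator {x..} s \<partial>lborel) = ennreal (0 - ?F x)"
    using d nn by (intro nn_integral_FTC_atLeast) auto
  also have "(\<integral>\<^sup>+s. ennreal (?f s) * indicator {x..} s \<partial>lborel)
      = (\<integral>\<^sup>+s. ennreal (indicator {x..} s * ?f s) \<partial>lborel)"
    by (intro nn_integral_cong) (auto simp: indicator_def)
  finally have eq: "(\<integral>\<^sup>+s. ennreal (indicator {x..} s * ?f s) \<partial>lborel) = ennreal (poisson_cdf n (real n + x * sqrt n))"
    by simp
  have y: "real n + x * sqrt n \<ge> 0"
  proof -
    have "- sqrt n * sqrt n \<le> x * sqrt n" using x by (intro mult_right_mono) auto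
    thus ?thesis by simp
  qed
  have "poisson_cdf n (real n + x * sqrt n) \<ge> 0"
    unfolding poisson_cdf_def exp_poly_def using y by (intro mult_nonneg_nonneg sum_nonneg) auto
  moreover have "(LINT s|lborel. indicator {x..} s * ?f s)
      = enn2real (\<integral>\<^sup>+s. ennreal (indicator {x..} s * ?f s) \<partial>lborel)"
    using nn by (intro integral_eq_nn_integral) (auto simp: indicator_def)
  ultimately have "poisson_cdf n (real n + x * sqrt n) = (LINT s|lborel. indicator {x..} s * ?f s)"
    unfolding eq by simp
  also have "\<dots> = stirling_ratio n * (LINT s|lborel. indicator {x..} s * scaled_density n s)"
    by (simp add: mult.left_commute flip: integral_mult_right_zero)
  finally show ?thesis .
qed

section \<open>Dominated convergence to the Gaussian density\<close>

lemma ln_add_one_upper_neg: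
  fixes u :: real assumes "-1 < u" "u \<le> 0"
  shows "ln (1 + u) \<le> u - u\<^sup>2 / 2"
proof -
  let ?f = "\<lambda>u::real. ln (1 + u) - u + u\<^sup>2 / 2"
  have "?f u \<le> ?f 0"
  proof (rule DERIV_nonneg_imp_nondecreasing[OF assms(2)])
    fix x assume x: "u \<le> x" "x \<le> 0"
    have "(?f has_real_derivative x\<^sup>2 / (1 + x)) (at x)"
      using x assms by (auto intro!: derivative_eq_intros simp: field_simps power2_eq_square)
    thus "\<exists>y. (?f has_real_derivative y) (at x) \<and> 0 \<le> y" using x assms by (intro exI conjI) auto
  qed
  thus ?thesis by simp
qed

text \<open>The bound \<open>u - u\<^sup>2 / 2\<close> fails for \<open>u > 0\<close>; the extra
  factor \<open>1 + u\<close> reflects that \<open>ln (1 + u) - u\<close> decreases only linearly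
  for large \<open>u\<close>.\<close>

lemma ln_add_one_upper_pos:
  fixes u :: real assumes "0 \<le> u"
  shows "ln (1 + u) \<le> u - u\<^sup>2 / (2 * (1 + u))"
proof -
  let ?f = "\<lambda>u::real. u - u\<^sup>2 / (2 * (1 + u)) - ln (1 + u)"
  have "?f 0 \<le> ?f u"
  proof (rule DERIV_nonneg_imp_nondecreasing[OF assms])
    fix x assume x: "0 \<le> x" "x \<le> u"
    have "(?f has_real_derivative 1 - (2 * x * (2 * (1 + x)) - x\<^sup>2 * 2) / (2 * (1 + x))\<^sup>2 - 1 / (1 + x)) (at x)"
      using x by (auto intro!: derivative_eq_intros simp: power2_eq_square)
    moreover have "1 - (2 * x * (2 * (1 + x)) - x\<^sup>2 * 2) / (2 * (1 + x))\<^sup>2 - 1 / (1 + x) = x\<^sup>2 / (2 * (1 + x)\<^sup>2)"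
      using x by (simp add: divide_simps) (simp add: algebra_simps power2_eq_square)
    ultimately show "\<exists>y. (?f has_real_derivative y) (at x) \<and> 0 \<le> y"
      using x by (intro exI[of _ "x\<^sup>2 / (2 * (1 + x)\<^sup>2)"]) auto
  qed
  thus ?thesis by simp
qed

lemma scaled_density_exp:
  assumes n: "n > 0" and s: "s > - sqrt n"
  shows "scaled_density n s = exp (real n * (ln (1 + s / sqrt n) - s / sqrt n))"
proof -
  have pos: "1 + s / sqrt n > 0" using n s by (simp add: field_simps)
  have "real n * (s / sqrt n) = s * sqrt n" using n by (simp add: field_simps)
  moreover have "(1 + s / sqrt n) ^ n = exp (real n * ln (1 + s / sqrt n))"
    using pos by (simp add: exp_of_nat_mult)
  ultimately show ?thesis unfolding scaled_density_def
    by (simp add: right_diff_distrib exp_diff exp_minus field_simps)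
qed

lemma scaled_density_le_neg:
  assumes n: "n > 0" and s: "s \<ge> - sqrt n" "s \<le> 0"
  shows "scaled_density n s \<le> exp (- (1/2) * s\<^sup>2)"
proof (cases "s = - sqrt n")
  case True
  thus ?thesis using n by (simp add: scaled_density_def zero_power)
next
  case False
  hence s': "s > - sqrt n" using s by simp
  define u where "u = s / sqrt n"
  have u: "-1 < u" "u \<le> 0" "real n * u\<^sup>2 = s\<^sup>2"
    using n s s' by (simp_all add: u_def field_simps power_divide)
  have "real n * (ln (1 + u) - u) \<le> real n * (- (u\<^sup>2 / 2))"
    using ln_add_one_upper_neg[OF u(1,2)] by (intro mult_left_mono) auto
  also have "\<dots> = - (1/2) * s\<^sup>2" using u(3) by simp
  finally show ?thesis unfolding scaled_density_exp[OF n s'] u_def by simp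
qed

text \<open>Already for \<open>n = 1\<close> the decay is only exponential. Since
  \<open>sqrt n \<ge> 1\<close>, the \<open>u\<close> in the denominator may be replaced by
  \<open>s\<close>, and \<open>s\<^sup>2 / (1 + s) \<ge> s - 1\<close> gives a bound free of
  \<open>n\<close>.\<close>

lemma scaled_density_le_pos:
  assumes n: "n > 0" and s: "s \<ge> 0"
  shows "scaled_density n s \<le> exp ((1 - s) / 2)"
proof -
  have sq: "sqrt n \<ge> 1" using n by simp
  have s': "s > - sqrt n" using s sq by linarith
  define u where "u = s / sqrt n"
  have u: "0 \<le> u" "real n * u\<^sup>2 = s\<^sup>2"
    using n s by (simp_all add: u_def power_divide)
  have "s / sqrt n \<le> s / 1" using s sq by (intro divide_left_mono) auto
  hence us: "u \<le> s" by (simp add: u_def)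
  have "real n * (ln (1 + u) - u) \<le> real n * (- (u\<^sup>2 / (2 * (1 + u))))"
    using ln_add_one_upper_pos[OF u(1)] by (intro mult_left_mono) auto
  also have "\<dots> = - (s\<^sup>2 / (2 * (1 + u)))" using u(2) by simp
  also have "\<dots> \<le> - (s\<^sup>2 / (2 * (1 + s)))"
    unfolding neg_le_iff_le using u(1) us s by (intro divide_left_mono mult_pos_pos) auto
  also have "\<dots> \<le> (1 - s) / 2"
  proof -
    have "(1 - s) / 2 + s\<^sup>2 / (2 * (1 + s)) = 1 / (2 * (1 + s))"
      using s by (simp add: divide_simps) (simp add: algebra_simps power2_eq_square)
    moreover have "1 / (2 * (1 + s)) \<ge> 0" using s by simp
    ultimately show ?thesis by linarith
  qed
  finally show ?thesis unfolding scaled_density_exp[OF n s'] u_def by simp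
qed

lemma scaled_density_tendsto:
  assumes n: "\<And>k. n k > 0" "filterlim n at_top sequentially" and s: "s \<longlonglongrightarrow> x"
  shows "(\<lambda>k. scaled_density (n k) (s k)) \<longlonglongrightarrow> exp (- (1/2) * x\<^sup>2)"
proof -
  \<comment> \<open>The exponent is \<open>s\<^sup>2 * h (s / sqrt n)\<close> with \<open>h\<close>
    continuous at 0, which handles moving arguments \<open>s k\<close>, zero included.\<close>
  define h where "h u = (if u = 0 then - 1/2 else (ln (1 + u) - u) / u\<^sup>2)" for u :: real
  have "((\<lambda>u::real. (ln (1 + u) - u) / u\<^sup>2) \<longlongrightarrow> - 1/2) (at 0)" by real_asymp
  hence "(h \<longlongrightarrow> - 1/2) (at 0)"
    by (rule Lim_transform_eventually) (auto simp: h_def eventually_at_filter)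
  hence "(h \<longlongrightarrow> h 0) (at 0)" by (simp add: h_def)
  hence h: "isCont h 0" by (simp add: isCont_def)
  have sq: "filterlim (\<lambda>k. sqrt (real (n k))) at_top sequentially"
    by (intro filterlim_compose[OF sqrt_at_top] filterlim_compose[OF filterlim_real_sequentially] n)
  hence u: "(\<lambda>k. s k / sqrt (n k)) \<longlonglongrightarrow> 0"
    by (rule tendsto_divide_0[OF s filterlim_at_top_imp_at_infinity])
  have "(\<lambda>k. exp ((s k)\<^sup>2 * h (s k / sqrt (n k)))) \<longlonglongrightarrow> exp (x\<^sup>2 * h 0)"
    by (intro tendsto_exp tendsto_mult tendsto_power s isCont_tendsto_compose[OF h] u)
  moreover have "\<forall>\<^sub>F k in sequentially. exp ((s k)\<^sup>2 * h (s k / sqrt (n k))) = scaled_density (n k) (s k)"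
  proof -
    have "\<forall>\<^sub>F k in sequentially. -1 < s k / sqrt (n k)" using order_tendstoD(1)[OF u, of "-1"] by simp
    thus ?thesis
    proof eventually_elim
      case (elim k)
      have "s k > - sqrt (n k)" using elim n(1)[of k] by (simp add: field_simps)
      from scaled_density_exp[OF n(1) this] show ?case
        using n(1)[of k] by (simp add: h_def power_divide)
    qed
  qed
  ultimately have "(\<lambda>k. scaled_density (n k) (s k)) \<longlonglongrightarrow> exp (x\<^sup>2 * h 0)"
    by (rule Lim_transform_eventually)
  thus ?thesis by (simp add: h_def mult.commute)
qed

lemma integrable_dominating: "integrable lborel (\<lambda>s. indicator {0..} s * exp ((1 - s) / 2) + exp (- (1/2) * s\<^sup>2) :: real)"
proof (intro Bochner_Integration.integrable_add integral_exp_minus_square)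
  have lim: "((\<lambda>s::real. - 2 * exp ((1 - s) / 2)) \<longlongrightarrow> 0) at_top" by real_asymp
  have "(\<integral>\<^sup>+s. ennreal (exp ((1 - s) / 2)) * indicator {0..} s \<partial>lborel) = ennreal (0 - (- 2 * exp ((1 - 0) / 2)))"
    by (rule nn_integral_FTC_atLeast[OF _ _ _ lim]) (auto intro!: derivative_eq_intros)
  also have "(\<integral>\<^sup>+s. ennreal (exp ((1 - s) / 2)) * indicator {0..} s \<partial>lborel)
      = (\<integral>\<^sup>+s. ennreal (indicator {0..} s * exp ((1 - s) / 2)) \<partial>lborel)"
    by (intro nn_integral_cong) (auto simp: indicator_def)
  finally show "integrable lborel (\<lambda>s::real. indicator {0..} s * exp ((1 - s) / 2))"
    by (intro integrableI_nn_integral_finite) auto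
qed simp

text \<open>The limit \<open>L\<close> of the cut-offs is kept general: the constant 1 when the
  tails start ever further to the left, a half line at the edge. Convergence is asked almost
  everywhere, since the indicators need not converge at the end point of the half line.\<close>

lemma tail_integral_tendsto:
  assumes n: "\<And>k. n k > 0" "filterlim n at_top sequentially"
    and x: "\<And>k. x k \<ge> - sqrt (n k)"
    and L: "AE s in lborel. (\<lambda>k. indicator {x k..} s :: real) \<longlonglongrightarrow> L s" and [measurable]: "L \<in> borel_measurable borel"
  shows "(\<lambda>k. LINT s|lborel. indicator {x k..} s * scaled_density (n k) s)
    \<longlonglongrightarrow> (LINT s|lborel. L s * exp (- (1/2) * s\<^sup>2))"
proof (rule integral_dominated_convergence)
  show "integrable lborel (\<lambda>s. indicator {0..} s * exp ((1 - s) / 2) + exp (- (1/2) * s\<^sup>2) :: real)"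
    by (rule integrable_dominating)
  show "AE s in lborel. (\<lambda>k. indicator {x k..} s * scaled_density (n k) s) \<longlonglongrightarrow> L s * exp (- (1/2) * s\<^sup>2)"
    using L by eventually_elim (intro tendsto_mult scaled_density_tendsto n tendsto_const)
  show "AE s in lborel. norm (indicator {x k..} s * scaled_density (n k) s)
      \<le> indicator {0..} s * exp ((1 - s) / 2) + exp (- (1/2) * s\<^sup>2)" for k
  proof (rule AE_I2)
    fix s :: real
    show "norm (indicator {x k..} s * scaled_density (n k) s)
      \<le> indicator {0..} s * exp ((1 - s) / 2) + exp (- (1/2) * s\<^sup>2)"
    proof (cases "x k \<le> s")
      case True
      hence s: "s \<ge> - sqrt (n k)" using x[of k] by linarith
      have "scaled_density (n k) s \<le> indicator {0..} s * exp ((1 - s) / 2) + exp (- (1/2) * s\<^sup>2)"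
        using scaled_density_le_pos[OF n(1)[of k], of s] scaled_density_le_neg[OF n(1) s]
        by (cases "s \<ge> 0") (auto intro: add_increasing2)
      thus ?thesis using True scaled_density_nonneg[OF n(1) s] by simp
    qed simp
  qed
qed simp_all

text \<open>At mean 0 the distribution function is 1, so \<open>stirling_ratio\<close> is the
  reciprocal of the full integral, which tends to the Gaussian integral. Stirling's formula is thus
  a result here, not an input.\<close>

lemma stirling_ratio_tendsto: "stirling_ratio \<longlonglongrightarrow> 1 / sqrt (2 * pi)"
proof -
  have "(\<lambda>k. LINT s|lborel. indicator {- sqrt (Suc k)..} s * scaled_density (Suc k) s)
    \<longlonglongrightarrow> (LINT s|lborel. 1 * exp (- (1/2) * s\<^sup>2))"
  proof (rule tail_integral_tendsto)
    show "filterlim Suc at_top sequentially" by (rule filterlim_Suc)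
    show "AE s in lborel. (\<lambda>k. indicator {- sqrt (Suc k)..} s :: real) \<longlonglongrightarrow> 1"
    proof (rule AE_I2)
      fix s :: real
      have "\<forall>\<^sub>F k in sequentially. - s \<le> sqrt (Suc k)"
        using filterlim_compose[OF sqrt_at_top filterlim_compose[OF filterlim_real_sequentially filterlim_Suc]]
        by (simp add: filterlim_at_top)
      hence "\<forall>\<^sub>F k in sequentially. 1 = (indicator {- sqrt (Suc k)..} s :: real)"
        by eventually_elim (auto simp: indicator_def)
      thus "(\<lambda>k. indicator {- sqrt (Suc k)..} s :: real) \<longlonglongrightarrow> 1"
        by (rule Lim_transform_eventually[OF tendsto_const])
    qed
  qed simp_all
  also have "(LINT s|lborel. 1 * exp (- (1/2) * s\<^sup>2)) = sqrt (2 * pi)"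
    using integral_exp_minus_square(2)[of "1/2"] by (simp add: mult.commute)
  finally have "(\<lambda>k. 1 / (LINT s|lborel. indicator {- sqrt (Suc k)..} s * scaled_density (Suc k) s)) \<longlonglongrightarrow> 1 / sqrt (2 * pi)"
    by (intro tendsto_divide tendsto_const) simp_all
  also have "(\<lambda>k. 1 / (LINT s|lborel. indicator {- sqrt (Suc k)..} s * scaled_density (Suc k) s)) = (\<lambda>k. stirling_ratio (Suc k))"
  proof
    fix k
    have "poisson_cdf (Suc k) 0 = 1"
      unfolding poisson_cdf_def exp_poly_def by (subst sum.remove[of _ 0]) (auto intro!: sum.neutral)
    hence "1 = stirling_ratio (Suc k) * (LINT s|lborel. indicator {- sqrt (Suc k)..} s * scaled_density (Suc k) s)"
      using poisson_cdf_integral[of "Suc k" "- sqrt (Suc k)"] by simp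
    thus "1 / (LINT s|lborel. indicator {- sqrt (Suc k)..} s * scaled_density (Suc k) s) = stirling_ratio (Suc k)"
      by (metis mult_zero_right nonzero_mult_div_cancel_right zero_neq_one)
  qed
  finally show ?thesis by (rule LIMSEQ_imp_Suc)
qed


lemma stirling_ratio_tendsto_compose:
  "filterlim n at_top sequentially \<Longrightarrow> (\<lambda>k. stirling_ratio (n k)) \<longlonglongrightarrow> 1 / sqrt (2 * pi)"
  by (rule filterlim_compose[OF stirling_ratio_tendsto])

section \<open>Limits of the distribution functions and of the half-integer terms\<close>

lemma erfc_lebesgue: "erfc x = 2 / sqrt pi * (LINT t|lborel. indicator {x..} t * exp (- t\<^sup>2))"
proof -
  have "set_integrable lborel {x..} (\<lambda>t. exp (- t\<^sup>2))"
    unfolding set_integrable_def using integral_exp_minus_square(1)[of 1]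
    by (intro integrable_mult_indicator) simp_all
  from set_borel_integral_eq_integral(2)[OF this] show ?thesis
    by (simp add: erfc_def set_lebesgue_integral_def)
qed

lemma gaussian_tail_erfc:
  "1 / sqrt (2 * pi) * (LINT s|lborel. indicator {x..} s * exp (- (1/2) * s\<^sup>2)) = erfc (x / sqrt 2) / 2"
proof -
  have "(LINT s|lborel. indicator {x..} s * exp (- (1/2) * s\<^sup>2))
      = \<bar>sqrt 2\<bar> *\<^sub>R (LINT t|lborel. indicator {x..} (0 + sqrt 2 * t) * exp (- (1/2) * (0 + sqrt 2 * t)\<^sup>2))"
    by (rule lborel_integral_real_affine) simp
  also have "(\<lambda>t. indicator {x..} (0 + sqrt 2 * t) * exp (- (1/2) * (0 + sqrt 2 * t)\<^sup>2))
      = (\<lambda>t. indicator {x / sqrt 2..} t * exp (- t\<^sup>2) :: real)"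
    by (auto simp: fun_eq_iff indicator_def field_simps)
  finally show ?thesis by (simp add: erfc_lebesgue real_sqrt_mult)
qed

lemma poisson_cdf_tendsto_erfc:
  assumes n: "\<And>k. n k > 0" "filterlim n at_top sequentially"
    and x: "\<And>k. x k \<ge> - sqrt (n k)" "x \<longlonglongrightarrow> c"
  shows "(\<lambda>k. poisson_cdf (n k) (real (n k) + x k * sqrt (n k))) \<longlonglongrightarrow> erfc (c / sqrt 2) / 2"
proof -
  \<comment> \<open>At \<open>s = c\<close> the indicators may oscillate, so this point is
    discarded.\<close>
  have "AE s in lborel. s \<noteq> c" by (rule AE_lborel_singleton)
  hence L: "AE s in lborel. (\<lambda>k. indicator {x k..} s :: real) \<longlonglongrightarrow> indicator {c..} s"
  proof eventually_elim
    case (elim s)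
    have "\<forall>\<^sub>F k in sequentially. indicator {c..} s = (indicator {x k..} s :: real)"
    proof (cases "s < c")
      case True
      from order_tendstoD(1)[OF x(2) this] show ?thesis
        by eventually_elim (use True in \<open>auto simp: indicator_def\<close>)
    next
      case False
      hence "c < s" using elim by simp
      from order_tendstoD(2)[OF x(2) this] show ?thesis
        by eventually_elim (use False in \<open>auto simp: indicator_def\<close>)
    qed
    thus ?case by (rule Lim_transform_eventually[OF tendsto_const])
  qed
  show ?thesis
    unfolding poisson_cdf_integral[OF n(1) x(1)] gaussian_tail_erfc[symmetric]
    by (intro tendsto_mult stirling_ratio_tendsto_compose tail_integral_tendsto n x(1) L) simp
qed

lemma poisson_cdf_tendsto_1:
  assumes n: "\<And>k. n k > 0" "filterlim n at_top sequentially"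
    and x: "\<And>k. x k \<ge> - sqrt (n k)" "filterlim x at_bot sequentially"
  shows "(\<lambda>k. poisson_cdf (n k) (real (n k) + x k * sqrt (n k))) \<longlonglongrightarrow> 1"
proof -
  have L: "AE s in lborel. (\<lambda>k. indicator {x k..} s :: real) \<longlonglongrightarrow> 1"
  proof (rule AE_I2)
    fix s :: real
    have "\<forall>\<^sub>F k in sequentially. x k \<le> s" using x(2) by (simp add: filterlim_at_bot)
    hence "\<forall>\<^sub>F k in sequentially. 1 = (indicator {x k..} s :: real)"
      by eventually_elim (auto simp: indicator_def)
    thus "(\<lambda>k. indicator {x k..} s :: real) \<longlonglongrightarrow> 1"
      by (rule Lim_transform_eventually[OF tendsto_const])
  qed
  have "(\<lambda>k. poisson_cdf (n k) (real (n k) + x k * sqrt (n k)))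
      \<longlonglongrightarrow> 1 / sqrt (2 * pi) * (LINT s|lborel. 1 * exp (- (1/2) * s\<^sup>2))"
    unfolding poisson_cdf_integral[OF n(1) x(1)]
    by (intro tendsto_mult stirling_ratio_tendsto_compose tail_integral_tendsto n x(1) L) simp
  also have "(LINT s|lborel. 1 * exp (- (1/2) * s\<^sup>2)) = sqrt (2 * pi)"
    using integral_exp_minus_square(2)[of "1/2"] by (simp add: mult.commute)
  finally show ?thesis by simp
qed

lemma scaled_density_tendsto_0:
  assumes n: "\<And>k. n k > 0" and x: "\<And>k. x k \<ge> - sqrt (n k)" "filterlim x at_bot sequentially"
  shows "(\<lambda>k. scaled_density (n k) (x k)) \<longlonglongrightarrow> 0"
proof (rule tendsto_sandwich[OF _ _ tendsto_const])
  show "\<forall>\<^sub>F k in sequentially. 0 \<le> scaled_density (n k) (x k)"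
    using scaled_density_nonneg[OF n x(1)] by simp
  have "\<forall>\<^sub>F k in sequentially. x k \<le> 0" using x(2) by (simp add: filterlim_at_bot)
  thus "\<forall>\<^sub>F k in sequentially. scaled_density (n k) (x k) \<le> exp (- (1/2) * (x k)\<^sup>2)"
    by eventually_elim (rule scaled_density_le_neg[OF n x(1)])
  have "((\<lambda>s::real. exp (- (1/2) * s\<^sup>2)) \<longlongrightarrow> 0) at_bot" by real_asymp
  thus "(\<lambda>k. exp (- (1/2) * (x k)\<^sup>2)) \<longlonglongrightarrow> 0" by (rule filterlim_compose[OF _ x(2)])
qed

text \<open>By the duplication formula \<open>pochhammer (1/2) n\<close> is
  \<open>(2n)! / (4^n n!)\<close>, so the constant is a quotient of Stirling ratios at
  \<open>2n\<close> and \<open>n\<close>. Its limit \<open>1 / sqrt 2\<close> is the source of the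
  coefficient \<open>sqrt 2\<close> in the denominator of \<open>rho_e\<close>.\<close>

lemma half_term_scaled:
  assumes n: "n > 0"
  shows "exp (- (real n + s * sqrt n)) * half_term n (real n + s * sqrt n)
    = stirling_ratio (2 * n) / (sqrt 2 * stirling_ratio n) * scaled_density n s"
proof -
  have P: "pochhammer (1/2) n > (0::real)" by (rule pochhammer_pos) simp
  have f: "fact (2 * n) = (4 :: real) ^ n * (pochhammer (1/2) n * fact n)"
    by (simp add: fact_double power_mult)
  have "stirling_ratio (2 * n) / (sqrt 2 * stirling_ratio n) = real n ^ n * exp (- real n) / pochhammer (1/2) n"
  proof -
    have "real (2 * n) ^ (2 * n) = 4 ^ n * (real n ^ n * real n ^ n)"
      by (simp add: power_mult_distrib power_mult power2_eq_square)
    moreover have "exp (- real (2 * n)) = exp (- real n) * exp (- real n)" by (simp flip: exp_add)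
    ultimately show ?thesis
      unfolding stirling_ratio_def f using n P by (simp add: real_sqrt_mult field_simps)
  qed
  moreover have "exp (- (real n + s * sqrt n)) * half_term n (real n + s * sqrt n)
      = (exp (- (real n + s * sqrt n)) * (real n + s * sqrt n) ^ n) / pochhammer (1/2) n"
    by (simp add: half_term_def)
  ultimately show ?thesis unfolding poisson_weight_scaled[OF n] by simp
qed

text \<open>Convergence along moving points forces uniform convergence on compact sets. To compare
  \<open>g (c (r k))\<close> with \<open>g l\<close> without continuity of \<open>g\<close>, a
  second sequence of indices \<open>m\<close> is chosen along which \<open>f\<close> is close to
  \<open>g\<close> at the very same points; both sequences of values tend to
  \<open>g l\<close>.\<close>

lemma uniform_limit_compact_sequentially:
  fixes f :: "nat \<Rightarrow> 'a::metric_space \<Rightarrow> 'b::metric_space"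
  assumes K: "compact K"
    and lim: "\<And>n c x. (\<And>k. n k > 0) \<Longrightarrow> filterlim n at_top sequentially \<Longrightarrow> (\<And>k. c k \<in> K) \<Longrightarrow> x \<in> K \<Longrightarrow>
      c \<longlonglongrightarrow> x \<Longrightarrow> (\<lambda>k. f (n k) (c k)) \<longlonglongrightarrow> g x"
  shows "uniform_limit K f g sequentially"
proof (rule ccontr)
  assume "\<not> uniform_limit K f g sequentially"
  then obtain e where e: "e > 0" and "\<not> (\<forall>\<^sub>F N in sequentially. \<forall>x\<in>K. dist (f N x) (g x) < e)"
    unfolding uniform_limit_iff by blast
  hence "\<forall>k. \<exists>N x. N \<ge> Suc k \<and> x \<in> K \<and> dist (f N x) (g x) \<ge> e"
    unfolding eventually_sequentially by (meson not_less)
  then obtain n c where nc: "\<And>k. n k \<ge> Suc k" "\<And>k. c k \<in> K" "\<And>k. dist (f (n k) (c k)) (g (c k)) \<ge> e"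
    by metis
  obtain l r where l: "l \<in> K" and r: "strict_mono r" and cl: "(c \<circ> r) \<longlonglongrightarrow> l"
    using K nc(2) unfolding compact_def by blast
  have top: "filterlim h at_top sequentially" if "\<And>k. h k \<ge> Suc k" for h :: "nat \<Rightarrow> nat"
    using that by (intro filterlim_at_top_mono[OF filterlim_ident]) (auto intro!: always_eventually dest: Suc_leD)
  have nr: "n (r k) \<ge> Suc k" for k using nc(1)[of "r k"] seq_suble[OF r, of k] by linarith
  have A: "(\<lambda>k. f (n (r k)) (c (r k))) \<longlonglongrightarrow> g l"
  proof (rule lim)
    show "n (r k) > 0" for k using nr[of k] by linarith
    show "filterlim (\<lambda>k. n (r k)) at_top sequentially" by (rule top[OF nr])
  qed (use nc l cl in \<open>simp_all add: o_def\<close>)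
  have "\<exists>N\<ge>Suc k. dist (f N (c (r k))) (g (c (r k))) < e / 2" for k
  proof -
    have "(\<lambda>N. f (Suc N) (c (r k))) \<longlonglongrightarrow> g (c (r k))"
      using nc(2) by (intro lim) (simp_all add: filterlim_Suc)
    hence "\<forall>\<^sub>F N in sequentially. dist (f (Suc N) (c (r k))) (g (c (r k))) < e / 2"
      using e by (intro tendstoD) simp_all
    then obtain N0 where "\<And>N. N \<ge> N0 \<Longrightarrow> dist (f (Suc N) (c (r k))) (g (c (r k))) < e / 2"
      unfolding eventually_sequentially by blast
    thus ?thesis by (intro exI[of _ "Suc (max N0 k)"]) simp
  qed
  then obtain m where m: "\<And>k. m k \<ge> Suc k" "\<And>k. dist (f (m k) (c (r k))) (g (c (r k))) < e / 2"
    by metis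
  have B: "(\<lambda>k. f (m k) (c (r k))) \<longlonglongrightarrow> g l"
  proof (rule lim)
    show "m k > 0" for k using m(1)[of k] by linarith
    show "filterlim m at_top sequentially" by (rule top[OF m(1)])
  qed (use nc l cl in \<open>simp_all add: o_def\<close>)
  have "\<forall>\<^sub>F k in sequentially. dist (f (n (r k)) (c (r k))) (g l) < e / 4"
    "\<forall>\<^sub>F k in sequentially. dist (f (m k) (c (r k))) (g l) < e / 4"
    using tendstoD[OF A, of "e / 4"] tendstoD[OF B, of "e / 4"] e by simp_all
  hence "\<forall>\<^sub>F k in sequentially. False"
  proof eventually_elim
    case (elim k)
    have "dist (f (n (r k)) (c (r k))) (g (c (r k)))
        \<le> dist (f (n (r k)) (c (r k))) (g l) + dist (f (m k) (c (r k))) (g l) + dist (f (m k) (c (r k))) (g (c (r k)))"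
      using dist_triangle[of "f (n (r k)) (c (r k))" "g (c (r k))" "g l"]
        dist_triangle[of "g l" "g (c (r k))" "f (m k) (c (r k))"] by (simp add: dist_commute)
    thus False using elim m(2)[of k] nc(3)[of "r k"] by linarith
  qed
  thus False by simp
qed

section \<open>Edge and bulk limits of the overlap\<close>

text \<open>Numerator and denominator are multiplied by \<open>exp (- 2y)\<close>, split into two
  factors \<open>exp (- y)\<close> wherever two series at \<open>y\<close> meet.\<close>

lemma Dhat_poisson:
  assumes N: "N > 0" and y: "y = a\<^sup>2"
  defines "Q1 \<equiv> poisson_cdf N y" and "Q2 \<equiv> poisson_cdf (2 * N) (2 * y)"
    and "v \<equiv> exp (- y) * half_term N y" and "b \<equiv> exp (- y) * (y ^ N / fact N)"
  shows "Dhat N a = ((2 * real N + 1 - 2 * y) * Q2 - (real N + 1 - y) * v * Q1 + y * v * b) / (3 * (Q2 - v * Q1))"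
proof -
  let ?A = "(2 * real N + 1 - 2 * y) * exp_poly (2 * N) (2 * y)
     + (y - real N - 1) * half_term N y * exp_poly N y + y * half_term N y * (y ^ N / fact N)"
  let ?B = "exp_poly (2 * N) (2 * y) - half_term N y * exp_poly N y"
  have e: "exp (- (2 * y)) = exp (- y) * exp (- y)" by (simp flip: exp_add)
  have 1: "(2 * real N + 1 - 2 * y) * Q2 - (real N + 1 - y) * v * Q1 + y * v * b = exp (- (2 * y)) * ?A"
    unfolding Q1_def Q2_def v_def b_def poisson_cdf_def e by (simp add: algebra_simps)
  have 2: "Q2 - v * Q1 = exp (- (2 * y)) * ?B"
    unfolding Q1_def Q2_def v_def poisson_cdf_def e by (simp add: algebra_simps)
  \<comment> \<open>For \<open>B = 0\<close> both sides are 0 by the convention for division by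
    zero.\<close>
  have gen: "2 / 3 * A / (2 * B) = e * A / (3 * (e * B))" if "e \<noteq> 0" for A B e :: real
    using that by (cases "B = 0") simp_all
  show ?thesis
    unfolding Dhat_closed_form[OF N] over_sum_def kernel_slope_def y[symmetric] 1 2 by (rule gen) simp
qed

text \<open>Up to a positive constant this is the limit of the denominator of \<open>Dhat\<close> at
  the edge, which has to be nonzero for the quotient of the limits.\<close>

lemma erfc_denominator_pos: "sqrt 2 * erfc (2 * c) - exp (-2 * c\<^sup>2) * erfc (sqrt 2 * c) > 0"
proof -
  let ?E = "\<lambda>q u. indicator {0..} u * (exp (- q * u\<^sup>2) * exp (- (2 * sqrt 2 * c * u + 4 * c\<^sup>2)))"
  \<comment> \<open>After shifting and scaling both integrals run over the half line with integrands that only differ in the Gaussian factor.\<close>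
  have 1: "sqrt 2 * erfc (2 * c) = 2 / sqrt pi * (LINT u|lborel. ?E (1/2) u)"
  proof -
    have "(LINT t|lborel. indicator {2 * c..} t * exp (- t\<^sup>2))
        = \<bar>1 / sqrt 2\<bar> *\<^sub>R (LINT u|lborel. indicator {2 * c..} (2 * c + 1 / sqrt 2 * u) * exp (- (2 * c + 1 / sqrt 2 * u)\<^sup>2))"
      by (rule lborel_integral_real_affine) simp
    also have "(\<lambda>u. indicator {2 * c..} (2 * c + 1 / sqrt 2 * u) * exp (- (2 * c + 1 / sqrt 2 * u)\<^sup>2)) = ?E (1/2)"
    proof
      fix u :: real
      have "indicator {2 * c..} (2 * c + 1 / sqrt 2 * u) = (indicator {0..} u :: real)"
        by (auto simp: indicator_def zero_le_divide_iff)
      moreover have "- (2 * c + 1 / sqrt 2 * u)\<^sup>2 = - (1/2) * u\<^sup>2 + - (2 * sqrt 2 * c * u + 4 * c\<^sup>2)"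
      proof -
        have "4 / sqrt 2 = 2 * sqrt 2" by (simp add: field_simps)
        hence "c * u * (4 / sqrt 2) = c * u * (2 * sqrt 2)" by (rule arg_cong)
        hence "4 * c * u / sqrt 2 = 2 * sqrt 2 * c * u" by (simp add: mult_ac)
        thus ?thesis by (simp add: power2_sum power_divide power_mult_distrib)
      qed
      ultimately show "indicator {2 * c..} (2 * c + 1 / sqrt 2 * u) * exp (- (2 * c + 1 / sqrt 2 * u)\<^sup>2) = ?E (1/2) u"
        by (simp only: exp_add)
    qed
    finally show ?thesis by (simp add: erfc_lebesgue)
  qed
  have 2: "exp (-2 * c\<^sup>2) * erfc (sqrt 2 * c) = 2 / sqrt pi * (LINT u|lborel. ?E 1 u)"
  proof -
    have "(LINT t|lborel. indicator {sqrt 2 * c..} t * exp (- t\<^sup>2))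
        = \<bar>1\<bar> *\<^sub>R (LINT u|lborel. indicator {sqrt 2 * c..} (sqrt 2 * c + 1 * u) * exp (- (sqrt 2 * c + 1 * u)\<^sup>2))"
      by (rule lborel_integral_real_affine) simp
    hence "exp (-2 * c\<^sup>2) * erfc (sqrt 2 * c) = 2 / sqrt pi *
        (LINT u|lborel. exp (-2 * c\<^sup>2) * (indicator {sqrt 2 * c..} (sqrt 2 * c + 1 * u) * exp (- (sqrt 2 * c + 1 * u)\<^sup>2)))"
      by (simp add: erfc_lebesgue)
    also have "(\<lambda>u. exp (-2 * c\<^sup>2) * (indicator {sqrt 2 * c..} (sqrt 2 * c + 1 * u) * exp (- (sqrt 2 * c + 1 * u)\<^sup>2))) = ?E 1"
    proof
      fix u :: real
      have i: "indicator {sqrt 2 * c..} (sqrt 2 * c + 1 * u) = (indicator {0..} u :: real)"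
        by (auto simp: indicator_def)
      have "-2 * c\<^sup>2 + - (sqrt 2 * c + 1 * u)\<^sup>2 = - 1 * u\<^sup>2 + - (2 * sqrt 2 * c * u + 4 * c\<^sup>2)"
        by (simp add: power2_sum power_mult_distrib)
      hence "exp (-2 * c\<^sup>2) * exp (- (sqrt 2 * c + 1 * u)\<^sup>2) = exp (- 1 * u\<^sup>2) * exp (- (2 * sqrt 2 * c * u + 4 * c\<^sup>2))"
        by (simp only: exp_add[symmetric])
      thus "exp (-2 * c\<^sup>2) * (indicator {sqrt 2 * c..} (sqrt 2 * c + 1 * u) * exp (- (sqrt 2 * c + 1 * u)\<^sup>2)) = ?E 1 u"
        unfolding i by (simp only: mult.left_commute)
    qed
    finally show ?thesis .
  qed
  have int: "integrable lborel (?E q)" if q: "q > 0" for q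
  proof -
    have "integrable lborel (\<lambda>u. indicator {0..} u *\<^sub>R (exp (- q * u\<^sup>2) * exp (- (2 * sqrt 2 * c * u + 4 * c\<^sup>2))))"
    proof (intro integrable_mult_indicator)
      \<comment> \<open>Completing the square: the shift \<open>t\<close> absorbs the term linear in
        \<open>u\<close>.\<close>
      define t where "t = sqrt 2 * c / q"
      have "exp (- q * u\<^sup>2) * exp (- (2 * sqrt 2 * c * u + 4 * c\<^sup>2)) = exp (q * t\<^sup>2 - 4 * c\<^sup>2) * exp (- q * (t + 1 * u)\<^sup>2)" for u
      proof -
        have "- q * u\<^sup>2 + - (2 * sqrt 2 * c * u + 4 * c\<^sup>2) = (q * t\<^sup>2 - 4 * c\<^sup>2) + - q * (t + 1 * u)\<^sup>2"
          using q by (simp add: t_def power2_sum algebra_simps)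
        thus ?thesis by (simp only: exp_add[symmetric])
      qed
      moreover have "integrable lborel (\<lambda>u. exp (- q * (t + 1 * u)\<^sup>2))"
        by (rule lborel_integrable_real_affine[OF integral_exp_minus_square(1)[OF q]]) simp
      ultimately show "integrable lborel (\<lambda>u. exp (- q * u\<^sup>2) * exp (- (2 * sqrt 2 * c * u + 4 * c\<^sup>2)))"
        by simp
    qed simp
    thus ?thesis by simp
  qed
  have "(LINT u|lborel. ?E (1/2) u - ?E 1 u) > 0"
  proof -
    have nn: "?E (1/2) u - ?E 1 u \<ge> 0" for u
      by (auto simp: indicator_def)
    \<comment> \<open>A vanishing integral would make the nonnegative difference vanish almost
      everywhere, although it is positive on an interval of positive length.\<close>
    have "(LINT u|lborel. ?E (1/2) u - ?E 1 u) \<noteq> 0"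
    proof
      assume "(LINT u|lborel. ?E (1/2) u - ?E 1 u) = 0"
      hence "AE u in lborel. ?E (1/2) u - ?E 1 u = 0"
        using integral_nonneg_eq_0_iff_AE[OF Bochner_Integration.integrable_diff[OF int[of "1/2"] int[of 1]]] nn by simp
      moreover have "?E (1/2) u - ?E 1 u \<noteq> 0" if "u > 0" for u
        using that by simp
      ultimately have "AE u in lborel. u \<notin> {0<..<1::real}"
        by (auto elim!: eventually_mono)
      hence "emeasure lborel {0<..<1::real} = 0"
        by (subst (asm) AE_iff_measurable[of "{0<..<1}"]) auto
      thus False by simp
    qed
    moreover have "(LINT u|lborel. ?E (1/2) u - ?E 1 u) \<ge> 0" using nn by (intro integral_nonneg_AE) auto
    ultimately show ?thesis by linarith
  qed
  hence "(LINT u|lborel. ?E (1/2) u) - (LINT u|lborel. ?E 1 u) > 0"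
    using int[of "1/2"] int[of 1] by simp
  moreover have "sqrt 2 * erfc (2 * c) - exp (-2 * c\<^sup>2) * erfc (sqrt 2 * c)
      = 2 / sqrt pi * ((LINT u|lborel. ?E (1/2) u) - (LINT u|lborel. ?E 1 u))"
    unfolding 1 2 by (simp only: right_diff_distrib)
  ultimately show ?thesis by simp
qed

text \<open>Here \<open>N - y\<close> is of order \<open>sqrt N\<close> and the point probability
  \<open>b\<close> at most of order \<open>1 / sqrt N\<close>, so each term of the numerator is at
  most of order \<open>sqrt N\<close>.\<close>

lemma Dhat_edge_tendsto:
  assumes n: "\<And>k. n k > 0" "filterlim n at_top sequentially" and c: "c \<longlonglongrightarrow> x"
  shows "(\<lambda>k. Dhat (n k) (sqrt (n k) + c k) / sqrt (n k)) \<longlonglongrightarrow> rho_e x"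
proof -
  define y where "y k = (sqrt (n k) + c k)\<^sup>2" for k
  define s where "s k = (y k - real (n k)) / sqrt (n k)" for k
  have sq0: "sqrt (n k) > 0" for k using n(1)[of k] by simp
  have ys: "y k = real (n k) + s k * sqrt (n k)" for k using sq0[of k] by (simp add: s_def)
  have sge: "s k \<ge> - sqrt (n k)" for k
  proof -
    have "y k \<ge> 0" by (simp add: y_def)
    hence "0 \<le> (sqrt (n k) + s k) * sqrt (n k)" unfolding ys by (simp add: algebra_simps)
    thus ?thesis using sq0[of k] by (simp add: zero_le_mult_iff)
  qed
  have sq: "filterlim (\<lambda>k. sqrt (real (n k))) at_top sequentially"
    by (intro filterlim_compose[OF sqrt_at_top] filterlim_compose[OF filterlim_real_sequentially] n)
  have inv: "(\<lambda>k. 1 / sqrt (n k)) \<longlonglongrightarrow> 0"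
    by (rule tendsto_divide_0[OF tendsto_const filterlim_at_top_imp_at_infinity[OF sq]])
  \<comment> \<open>From \<open>y = n + 2 * c * sqrt n + c\<^sup>2\<close>.\<close>
  have s: "s \<longlonglongrightarrow> 2 * x"
  proof -
    have "(\<lambda>k. 2 * c k + (c k)\<^sup>2 * (1 / sqrt (n k))) \<longlonglongrightarrow> 2 * x + x\<^sup>2 * 0"
      by (intro tendsto_intros c inv)
    moreover have "s = (\<lambda>k. 2 * c k + (c k)\<^sup>2 * (1 / sqrt (n k)))"
    proof
      fix k show "s k = 2 * c k + (c k)\<^sup>2 * (1 / sqrt (n k))"
        using sq0[of k] by (simp add: s_def y_def power2_sum field_simps)
    qed
    ultimately show ?thesis by simp
  qed
  define Q1 where "Q1 k = poisson_cdf (n k) (y k)" for k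
  define Q2 where "Q2 k = poisson_cdf (2 * n k) (2 * y k)" for k
  define v where "v k = exp (- y k) * half_term (n k) (y k)" for k
  define b where "b k = exp (- y k) * (y k ^ n k / fact (n k))" for k
  define b' where "b' k = b k * sqrt (n k)" for k
  have Q1: "Q1 \<longlonglongrightarrow> erfc (2 * x / sqrt 2) / 2"
    unfolding Q1_def ys by (rule poisson_cdf_tendsto_erfc[OF n sge s])
  have n2: "filterlim (\<lambda>k. 2 * n k) at_top sequentially"
    by (rule filterlim_at_top_mono[OF n(2)]) simp
  \<comment> \<open>Doubling index and mean multiplies the standardised distance by
    \<open>sqrt 2\<close>; this is how \<open>erfc\<close> comes to be evaluated at
    \<open>2 * x\<close> as well as at \<open>sqrt 2 * x\<close>.\<close>
  have Q2: "Q2 \<longlonglongrightarrow> erfc (sqrt 2 * (2 * x) / sqrt 2) / 2"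
  proof -
    have "Q2 k = poisson_cdf (2 * n k) (real (2 * n k) + (sqrt 2 * s k) * sqrt (2 * n k))" for k
      unfolding Q2_def ys by (simp add: real_sqrt_mult algebra_simps)
    moreover have "(\<lambda>k. poisson_cdf (2 * n k) (real (2 * n k) + (sqrt 2 * s k) * sqrt (2 * n k)))
        \<longlonglongrightarrow> erfc (sqrt 2 * (2 * x) / sqrt 2) / 2"
    proof (rule poisson_cdf_tendsto_erfc)
      show "2 * n k > 0" for k using n(1) by simp
      show "sqrt 2 * s k \<ge> - sqrt (2 * n k)" for k
        using mult_left_mono[OF sge[of k], of "sqrt 2"] by (simp add: real_sqrt_mult)
    qed (intro n2 tendsto_intros s)+
    ultimately show ?thesis by presburger
  qed
  have st: "(\<lambda>k. stirling_ratio (2 * n k) / (sqrt 2 * stirling_ratio (n k))) \<longlonglongrightarrow> (1 / sqrt (2 * pi)) / (sqrt 2 * (1 / sqrt (2 * pi)))"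
    by (intro tendsto_intros stirling_ratio_tendsto_compose n n2) simp
  have v: "v \<longlonglongrightarrow> (1 / sqrt (2 * pi)) / (sqrt 2 * (1 / sqrt (2 * pi))) * exp (- (1/2) * (2 * x)\<^sup>2)"
    unfolding v_def ys half_term_scaled[OF n(1)]
    by (intro tendsto_mult[OF st] scaled_density_tendsto n s)
  have b: "b' \<longlonglongrightarrow> 1 / sqrt (2 * pi) * exp (- (1/2) * (2 * x)\<^sup>2)"
  proof -
    have "b' k = stirling_ratio (n k) * scaled_density (n k) (s k)" for k
    proof -
      have "b' k = (exp (- y k) * y k ^ n k) * sqrt (n k) / fact (n k)" by (simp add: b_def b'_def)
      thus ?thesis unfolding ys poisson_weight_scaled[OF n(1)] by (simp add: stirling_ratio_def)
    qed
    hence "b' = (\<lambda>k. stirling_ratio (n k) * scaled_density (n k) (s k))" by (simp add: fun_eq_iff)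
    thus ?thesis by (simp only:) (intro tendsto_mult stirling_ratio_tendsto_compose scaled_density_tendsto n s)
  qed
  have yn: "(\<lambda>k. 1 + s k * (1 / sqrt (n k))) \<longlonglongrightarrow> 1 + 2 * x * 0"
    by (intro tendsto_intros s inv)
  have eq: "Dhat (n k) (sqrt (n k) + c k) / sqrt (n k)
      = ((1 / sqrt (n k) - 2 * s k) * Q2 k - (1 / sqrt (n k) - s k) * v k * Q1 k
          + (1 + s k * (1 / sqrt (n k))) * v k * b' k) / (3 * (Q2 k - v k * Q1 k))" for k
  proof -
    let ?r = "sqrt (n k)"
    have r: "?r > 0" "?r * ?r = real (n k)" using sq0[of k] by simp_all
    have e1: "2 * real (n k) + 1 - 2 * y k = ?r * (1 / ?r - 2 * s k)"
      "real (n k) + 1 - y k = ?r * (1 / ?r - s k)"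
      using r by (simp_all add: ys algebra_simps)
    have Y: "y k = ?r * ((1 + s k * (1 / ?r)) * ?r)"
      using r by (simp add: ys algebra_simps)
    have e2: "y k * v k * b k = ?r * ((1 + s k * (1 / ?r)) * v k * b' k)"
      unfolding b'_def by (subst Y) (simp only: mult_ac)
    have alg: "R * U * Q - R * W * V * T + R * Z = R * (U * Q - W * V * T + Z)" for R U Q W V T Z :: real
      by (simp add: algebra_simps)
    have "Dhat (n k) (sqrt (n k) + c k) = ((2 * real (n k) + 1 - 2 * y k) * Q2 k - (real (n k) + 1 - y k) * v k * Q1 k + y k * v k * b k)
        / (3 * (Q2 k - v k * Q1 k))"
      unfolding Q1_def Q2_def v_def b_def by (rule Dhat_poisson[OF n(1)]) (simp add: y_def)
    also have "\<dots> = ?r * ((1 / ?r - 2 * s k) * Q2 k - (1 / ?r - s k) * v k * Q1 k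
          + (1 + s k * (1 / ?r)) * v k * b' k) / (3 * (Q2 k - v k * Q1 k))"
      unfolding e1 e2 alg ..
    finally show ?thesis using r(1) by simp
  qed
  define d where "d = sqrt 2 * erfc (2 * x) - exp (-2 * x\<^sup>2) * erfc (sqrt 2 * x)"
  have d: "d > 0" unfolding d_def by (rule erfc_denominator_pos)
  have simps: "2 * x / sqrt 2 = sqrt 2 * x" "sqrt 2 * (2 * x) / sqrt 2 = 2 * x"
    "(1 / sqrt (2 * pi)) / (sqrt 2 * (1 / sqrt (2 * pi))) = 1 / sqrt 2"
    "- (1/2) * (2 * x)\<^sup>2 = - 2 * x\<^sup>2"
    by (simp_all add: field_simps power_mult_distrib)
  note Q1 = Q1[unfolded simps] and Q2 = Q2[unfolded simps] and v = v[unfolded simps] and b = b[unfolded simps]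
  have lim: "(\<lambda>k. Dhat (n k) (sqrt (n k) + c k) / sqrt (n k)) \<longlonglongrightarrow>
     ((0 - 2 * (2 * x)) * (erfc (2 * x) / 2) - (0 - 2 * x) * (1 / sqrt 2 * exp (- 2 * x\<^sup>2)) * (erfc (sqrt 2 * x) / 2)
       + (1 + 2 * x * 0) * (1 / sqrt 2 * exp (- 2 * x\<^sup>2)) * (1 / sqrt (2 * pi) * exp (- 2 * x\<^sup>2)))
      / (3 * (erfc (2 * x) / 2 - 1 / sqrt 2 * exp (- 2 * x\<^sup>2) * (erfc (sqrt 2 * x) / 2)))"
    unfolding eq
  proof (intro tendsto_divide tendsto_add tendsto_diff tendsto_mult tendsto_const inv s Q1 Q2 v b yn)
    have "erfc (2 * x) / 2 - 1 / sqrt 2 * exp (- 2 * x\<^sup>2) * (erfc (sqrt 2 * x) / 2) = d / (2 * sqrt 2)"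
      by (simp add: d_def field_simps)
    thus "3 * (erfc (2 * x) / 2 - 1 / sqrt 2 * exp (- 2 * x\<^sup>2) * (erfc (sqrt 2 * x) / 2)) \<noteq> 0"
      using d by simp
  qed
  have D: "erfc (2 * x) / 2 - 1 / sqrt 2 * exp (- 2 * x\<^sup>2) * (erfc (sqrt 2 * x) / 2) = d / (2 * sqrt 2)"
    by (simp add: d_def field_simps)
  have ee: "exp (- 2 * x\<^sup>2) * exp (- 2 * x\<^sup>2) = exp (- 4 * x\<^sup>2)" by (simp flip: exp_add)
  have Nn: "(0 - 2 * (2 * x)) * (erfc (2 * x) / 2) - (0 - 2 * x) * (1 / sqrt 2 * exp (- 2 * x\<^sup>2)) * (erfc (sqrt 2 * x) / 2)
       + (1 + 2 * x * 0) * (1 / sqrt 2 * exp (- 2 * x\<^sup>2)) * (1 / sqrt (2 * pi) * exp (- 2 * x\<^sup>2))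
     = 1 / (2 * sqrt pi) * (exp (-4 * x\<^sup>2) + sqrt (2*pi) * x * exp (-2 * x\<^sup>2) * erfc (sqrt 2 * x) - 4 * sqrt pi * x * erfc (2*x))"
  proof -
    define E where "E = exp (- 2 * x\<^sup>2)"
    define r2 where "r2 = sqrt (2::real)"
    define rp where "rp = sqrt pi"
    have r2: "r2 > 0" "r2 * r2 = 2" and rp: "rp > 0" and s2p: "sqrt (2 * pi) = r2 * rp"
      by (simp_all add: r2_def rp_def real_sqrt_mult)
    have r2i: "1 / r2 = r2 / 2" using r2 by (simp add: field_simps)
    have r2ii: "1 / (r2 * rp) = r2 / (2 * rp)" using r2 rp by (simp add: field_simps)
    have "1 / (2 * rp) * (E * E + r2 * rp * x * E * F - 4 * rp * x * G)
      = - (2 * x * G) + x * (r2 / 2 * E) * F + r2 / 2 * E * (r2 / (2 * rp) * E)" for F G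
    proof -
      have "r2 / 2 * E * (r2 / (2 * rp) * E) = (r2 * r2) * (E * E) / (4 * rp)" by simp
      also have "\<dots> = E * E / (2 * rp)" unfolding r2(2) by simp
      finally show ?thesis using rp by (simp add: field_simps)
    qed
    from this[of "erfc (sqrt 2 * x)" "erfc (2 * x)"] show ?thesis
      unfolding ee[symmetric] s2p E_def[symmetric] r2_def[symmetric] rp_def[symmetric] r2i r2ii by simp
  qed
  have "1 / (2 * sqrt pi) * M / (3 * (d / (2 * sqrt 2))) = sqrt 2 / (3 * sqrt pi) * (M / d)" for M
    using d by (simp add: field_simps)
  thus ?thesis using lim unfolding Nn D rho_e_def d_def[symmetric] by simp
qed

text \<open>In the bulk the mean \<open>y\<close> lies below \<open>N\<close> by a positive fraction
  of \<open>N\<close>, so both distribution functions tend to 1 while \<open>v\<close> and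
  \<open>b\<close> tend to 0. Only the first term of the numerator survives and leaves
  \<open>(2 - 2 * p\<^sup>2) / 3\<close>.\<close>

lemma Dhat_bulk_tendsto:
  assumes p: "-1 < p" "p < 1" and n: "\<And>k. n k > 0" "filterlim n at_top sequentially" and c: "c \<longlonglongrightarrow> x"
  shows "(\<lambda>k. Dhat (n k) (sqrt (n k) * p + c k) / real (n k)) \<longlonglongrightarrow> rho_b p"
proof -
  define y where "y k = (sqrt (n k) * p + c k)\<^sup>2" for k
  define s where "s k = (y k - real (n k)) / sqrt (n k)" for k
  have sq0: "sqrt (n k) > 0" for k using n(1)[of k] by simp
  have ys: "y k = real (n k) + s k * sqrt (n k)" for k using sq0[of k] by (simp add: s_def)
  have sge: "s k \<ge> - sqrt (n k)" for k
  proof -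
    have "y k \<ge> 0" by (simp add: y_def)
    hence "0 \<le> (sqrt (n k) + s k) * sqrt (n k)" unfolding ys by (simp add: algebra_simps)
    thus ?thesis using sq0[of k] by (simp add: zero_le_mult_iff)
  qed
  have sq: "filterlim (\<lambda>k. sqrt (real (n k))) at_top sequentially"
    by (intro filterlim_compose[OF sqrt_at_top] filterlim_compose[OF filterlim_real_sequentially] n)
  have inv: "(\<lambda>k. 1 / sqrt (n k)) \<longlonglongrightarrow> 0"
    by (rule tendsto_divide_0[OF tendsto_const filterlim_at_top_imp_at_infinity[OF sq]])
  have yn: "(\<lambda>k. y k / real (n k)) \<longlonglongrightarrow> p\<^sup>2"
  proof -
    have "(\<lambda>k. (p + c k * (1 / sqrt (n k)))\<^sup>2) \<longlonglongrightarrow> (p + x * 0)\<^sup>2"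
      by (intro tendsto_intros c inv)
    moreover have "(p + c k * (1 / sqrt (n k)))\<^sup>2 = y k / real (n k)" for k
    proof -
      have "p + c k * (1 / sqrt (n k)) = (sqrt (n k) * p + c k) / sqrt (n k)" using sq0[of k] by (simp add: field_simps)
      thus ?thesis by (simp add: y_def power_divide)
    qed
    ultimately show ?thesis by simp
  qed
  have p2: "p\<^sup>2 < 1" using p by (simp add: abs_square_less_1 abs_less_iff)
  have s: "filterlim s at_bot sequentially"
  proof -
    have "(\<lambda>k. 1 - y k / real (n k)) \<longlonglongrightarrow> 1 - p\<^sup>2" by (intro tendsto_intros yn)
    hence "filterlim (\<lambda>k. (1 - y k / real (n k)) * sqrt (n k)) at_top sequentially"
      by (rule filterlim_tendsto_pos_mult_at_top[OF _ _ sq]) (use p2 in linarith)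
    moreover have "(1 - y k / real (n k)) * sqrt (n k) = - s k" for k
    proof -
      have "sqrt (n k) / real (n k) = 1 / sqrt (n k)" using n(1)[of k] by (simp add: field_simps)
      hence "y k / real (n k) * sqrt (n k) = y k / sqrt (n k)" by (metis times_divide_eq_right times_divide_eq_left mult.right_neutral)
      moreover have "real (n k) / sqrt (n k) = sqrt (n k)" by (rule real_div_sqrt) simp
      ultimately show ?thesis by (simp add: s_def left_diff_distrib diff_divide_distrib)
    qed
    ultimately show ?thesis by (simp add: filterlim_uminus_at_top)
  qed
  define Q1 where "Q1 k = poisson_cdf (n k) (y k)" for k
  define Q2 where "Q2 k = poisson_cdf (2 * n k) (2 * y k)" for k
  define v where "v k = exp (- y k) * half_term (n k) (y k)" for k
  define b where "b k = exp (- y k) * (y k ^ n k / fact (n k))" for k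
  have Q1: "Q1 \<longlonglongrightarrow> 1"
    unfolding Q1_def ys by (rule poisson_cdf_tendsto_1[OF n sge s])
  have n2: "filterlim (\<lambda>k. 2 * n k) at_top sequentially"
    by (rule filterlim_at_top_mono[OF n(2)]) simp
  have Q2: "Q2 \<longlonglongrightarrow> 1"
  proof -
    have "Q2 k = poisson_cdf (2 * n k) (real (2 * n k) + (sqrt 2 * s k) * sqrt (2 * n k))" for k
      unfolding Q2_def ys by (simp add: real_sqrt_mult algebra_simps)
    moreover have "(\<lambda>k. poisson_cdf (2 * n k) (real (2 * n k) + (sqrt 2 * s k) * sqrt (2 * n k))) \<longlonglongrightarrow> 1"
    proof (rule poisson_cdf_tendsto_1)
      show "2 * n k > 0" for k using n(1) by simp
      show "sqrt 2 * s k \<ge> - sqrt (2 * n k)" for k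
        using mult_left_mono[OF sge[of k], of "sqrt 2"] by (simp add: real_sqrt_mult)
      show "filterlim (\<lambda>k. sqrt 2 * s k) at_bot sequentially"
        by (rule filterlim_tendsto_pos_mult_at_bot[OF tendsto_const _ s]) simp
    qed (rule n2)
    ultimately show ?thesis by presburger
  qed
  have st: "(\<lambda>k. stirling_ratio (2 * n k) / (sqrt 2 * stirling_ratio (n k))) \<longlonglongrightarrow> (1 / sqrt (2 * pi)) / (sqrt 2 * (1 / sqrt (2 * pi)))"
    by (intro tendsto_intros stirling_ratio_tendsto_compose n n2) simp
  have dens: "(\<lambda>k. scaled_density (n k) (s k)) \<longlonglongrightarrow> 0"
    by (rule scaled_density_tendsto_0[OF n(1) sge s])
  have v: "v \<longlonglongrightarrow> 0"
    unfolding v_def ys half_term_scaled[OF n(1)] using tendsto_mult[OF st dens] by simp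
  have b: "b \<longlonglongrightarrow> 0"
  proof -
    have "b k = stirling_ratio (n k) * scaled_density (n k) (s k) * (1 / sqrt (n k))" for k
    proof -
      have "b k = (exp (- y k) * y k ^ n k) / fact (n k)" by (simp add: b_def)
      thus ?thesis unfolding ys poisson_weight_scaled[OF n(1)] using n(1)[of k] by (simp add: stirling_ratio_def)
    qed
    hence "b = (\<lambda>k. stirling_ratio (n k) * scaled_density (n k) (s k) * (1 / sqrt (n k)))" by (simp add: fun_eq_iff)
    moreover have "(\<lambda>k. stirling_ratio (n k) * scaled_density (n k) (s k) * (1 / sqrt (n k))) \<longlonglongrightarrow> 1 / sqrt (2 * pi) * 0 * 0"
      by (intro tendsto_mult stirling_ratio_tendsto_compose n dens inv)
    ultimately show ?thesis by simp
  qed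
  have inv': "(\<lambda>k. 1 / real (n k)) \<longlonglongrightarrow> 0"
    by (rule tendsto_divide_0[OF tendsto_const filterlim_at_top_imp_at_infinity[OF filterlim_compose[OF filterlim_real_sequentially n(2)]]])
  have eq: "Dhat (n k) (sqrt (n k) * p + c k) / real (n k)
      = ((2 + 1 / real (n k) - 2 * (y k / real (n k))) * Q2 k - (1 + 1 / real (n k) - y k / real (n k)) * v k * Q1 k
          + y k / real (n k) * v k * b k) / (3 * (Q2 k - v k * Q1 k))" for k
  proof -
    let ?r = "real (n k)"
    have r: "?r > 0" using n(1)[of k] by simp
    have e: "2 * ?r + 1 - 2 * y k = ?r * (2 + 1 / ?r - 2 * (y k / ?r))" "?r + 1 - y k = ?r * (1 + 1 / ?r - y k / ?r)"
      using r by (simp_all add: field_simps)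
    have e2: "y k * v k * b k = ?r * (y k / ?r * v k * b k)" using r by simp
    have alg: "R * U * Q - R * W * V * T + R * Z = R * (U * Q - W * V * T + Z)" for R U Q W V T Z :: real
      by (simp add: algebra_simps)
    have "Dhat (n k) (sqrt (n k) * p + c k) = ((2 * ?r + 1 - 2 * y k) * Q2 k - (?r + 1 - y k) * v k * Q1 k + y k * v k * b k)
        / (3 * (Q2 k - v k * Q1 k))"
      unfolding Q1_def Q2_def v_def b_def by (rule Dhat_poisson[OF n(1)]) (simp add: y_def)
    also have "\<dots> = ?r * ((2 + 1 / ?r - 2 * (y k / ?r)) * Q2 k - (1 + 1 / ?r - y k / ?r) * v k * Q1 k
          + y k / ?r * v k * b k) / (3 * (Q2 k - v k * Q1 k))"
      unfolding e e2 alg ..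
    finally show ?thesis using r by simp
  qed
  have "(\<lambda>k. Dhat (n k) (sqrt (n k) * p + c k) / real (n k)) \<longlonglongrightarrow>
     ((2 + 0 - 2 * p\<^sup>2) * 1 - (1 + 0 - p\<^sup>2) * 0 * 1 + p\<^sup>2 * 0 * 0) / (3 * (1 - 0 * 1))"
    unfolding eq
    by (intro tendsto_divide tendsto_add tendsto_diff tendsto_mult tendsto_const inv' yn Q1 Q2 v b) simp
  thus ?thesis by (simp add: rho_b_def field_simps)
qed

theorem theorem2p7:
  fixes p :: real and K :: "real set"
  assumes "-1 < p" and "p \<le> 1" and "compact K"
  shows "uniform_limit K
           (\<lambda>N c. Dhat N (sqrt (real N) * p + c) / real N powr (if p = 1 then 1/2 else 1))
           (\<lambda>c. if p = 1 then rho_e c else rho_b p) sequentially"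
proof (rule uniform_limit_compact_sequentially[OF assms(3)])
  fix n :: "nat \<Rightarrow> nat" and c :: "nat \<Rightarrow> real" and x :: real
  assume n: "\<And>k. n k > 0" "filterlim n at_top sequentially" and c: "c \<longlonglongrightarrow> x"
  show "(\<lambda>k. Dhat (n k) (sqrt (real (n k)) * p + c k) / real (n k) powr (if p = 1 then 1/2 else 1))
      \<longlonglongrightarrow> (if p = 1 then rho_e x else rho_b p)"
  proof (cases "p = 1")
    case True
    thus ?thesis using Dhat_edge_tendsto[OF n c] by (simp add: powr_half_sqrt)
  next
    case False
    thus ?thesis using Dhat_bulk_tendsto[OF _ _ n c, of p] assms by simp
  qed
qed

end
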